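(* Let $H$ be a real Hilbert space, let $T_1,T_2:H\rightrightarrows H$ be two maximal monotone operators and $\gamma>0$. Given $(\beta_n)_{n\in\mathbb{N}}\subset(0,1]$, $(\lambda_n)_{n\in\mathbb{N}}\subset(0,2]$ and $x_0\in H$, let $(x_n),(y_n),(z_n)$ be generated, for all $n\in\mathbb{N}$, by $$y_n=J_{\gamma T_2}(\beta_n x_n),\qquad z_n=J_{\gamma T_1}(2y_n-\beta_n x_n),\qquad x_{n+1}=\beta_n x_n+\lambda_n(z_n-y_n).$$ Assume that there exist $\ell\in\mathbb{N}\setminus\{0\}$ and monotone functions $b,D,B,L:\mathbb{N}\to\mathbb{N}$ and $h:\mathbb{N}\to\mathbb{N}\setminus\{0\}$ such that 1. $\forall n\in\mathbb{N}\ \big(\beta_n\ge \frac{1}{h(n)}\big)$; 2. $\forall k\in\mathbb{N}\ \forall n\ge b(k)\ \big(|1-\beta_n|\le\frac{1}{k+1}\big)$; 3. $\forall k\in\mathbb{N}\ \big(\sum_{i=1}^{D(k)}(1-\beta_i)\ge k\big)$; 4. $\forall k\in\mathbb{N}\ \forall n\in\mathbb{N}\ \big(\sum_{i=B(k)+1}^{B(k)+n}|\beta_i-\beta_{i-1}|\le\frac{1}{k+1}\big)$; 5. $\forall n\in\mathbb{N}\ \big(\lambda_n\ge\frac1\ell\big)$; 6. $\forall k\in\mathbb{N}\ \forall n\in\mathbb{N}\ \big(\sum_{i=L(k)+1}^{L(k)+n}|\lambda_i-\lambda_{i-1}|\le\frac{1}{k+1}\big)$. Assume that there exists $N\in\mathbb{N}\setminus\{0\}$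 such that $N\ge\max\{\|x_0-p\|,\|p\|\}$ for some $p\in\mathrm{Fix}(R_{\gamma T_1}\circ R_{\gamma T_2})$. Then for all $k\in\mathbb{N}$ and all monotone functions $f:\mathbb{N}\to\mathbb{N}$, (i) $\exists n\le\mu_3(k,f)\ \forall i,j\in[n,f(n)]\ \big(\|x_i-x_j\|\le\frac{1}{k+1}\big)$, (ii) $\exists n\le\mu_4(k,f)\ \forall i,j\in[n,f(n)]\ \big(\|y_i-y_j\|\le\frac{1}{k+1}\big)$, (iii) $\exists n\le\mu_5(k,f)\ \forall i,j\in[n,f(n)]\ \big(\|z_i-z_j\|\le\frac{1}{k+1}\big)$, where $$\mu_3(k,f):=\mu[N,2\ell,b,h,D,B,L](k,f),$$ $$\mu_4(k,f):=\max\{\mu_3(2k+1,g_1),\,b(8N(k+1)-1)\},$$ $$\mu_5(k,f):=\max\{\mu_4(3k+2,g_2),\,\nu_1(6\ell(k+1)-1),\,b(12\ell N(k+1)-1)\},$$ with $g_1(m):=f(\max\{m,\,b(8N(k+1)-1)\})$ and $g_2(m):=f(\max\{m,\,\nu_1(6\ell(k+1)-1),\,b(12\ell N(k+1)-1)\})$ (so $g_1,g_2$ depend on the given $k,f$), and with $\mu$ and $\nu_1$ as defined in the context.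
   Context: $\mathbb{N}=\{0,1,2,\dots\}$. A function $f:\mathbb{N}\to\mathbb{N}$ is called monotone if it is nondecreasing. $[a,c]$ denotes the integer interval (empty if $c<a$). For a function $g:\mathbb{N}\to\mathbb{N}$, $g^{(R)}$ denotes its $R$-fold iterate. For a maximal monotone operator $\mathsf A:H\rightrightarrows H$ and $\gamma>0$, the resolvent is the single-valued map $J_{\gamma\mathsf A}=(\mathrm{Id}+\gamma\mathsf A)^{-1}:H\to H$ and the reflected resolvent is $R_{\gamma\mathsf A}:=2J_{\gamma\mathsf A}-\mathrm{Id}$. $\mathrm{Fix}\,T$ is the set of fixed points of a map $T$. Definition of $\nu_1=\nu_1[N,D,B,L]$ and $\mu[N,\ell,b,h,D,B,L]$, for arbitrary $N,\ell\in\mathbb{N}\setminus\{0\}$ and monotone functions $b,D,B,L:\mathbb{N}\to\mathbb{N}$, $h:\mathbb{N}\to\mathbb{N}\setminus\{0\}$ (in the claim $\mu$ is used with $2\ell$ in place of $\ell$; $\nu_1$ does not depend on $\ell$): - $G(k):=\max\{B(4N(k+1)-1),\,L(10N(k+1)-1)\}$. - $\nu_1(k):=D\big(M-1+\lceil\ln(6N(k+1))\rceil\big)+1$, where $M:=\max\{0,\,G(3k+2)+1\}$. - $\nu_2(k):=\max\{b(4N\ell(k+1)-1),\,\nu_1(2\ell(k+1)-1)\}$. - For $k\in\mathbb{N}$ and monotone $f:\mathbb{N}\to\mathbb{N}$: $\psi(k,f):=\nu_2\big(48N(\check g^{(R)}(0)+1)^2\big)$, where $g(m):=f(\nu_2(m))$,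 $R:=64N^4(k+1)^2$ and $\check g(m):=\max\{g(48N(m+1)^2),\,48N(m+1)^2\}$. - $\sigma(k,n):=D\big(n+\lceil\ln(27N^2(k+1))\rceil\big)+1$. - Given $k$ and $f$: $\widetilde k:=4(k+1)^2-1$, $n_1:=b(54N^2(\widetilde k+1)-1)$, $\overline f(m):=f\big(\sigma(\widetilde k,\max\{m,n_1\})\big)$, $\widetilde f(m):=3(10N+1)(\widetilde k+1)(\overline f(m)+1)\,h(\overline f(m))-1$. - $\mu(k,f):=\sigma\big(\widetilde k,\max\{\psi(12(\widetilde k+1)-1,\widetilde f),\,n_1\}\big)$. *)

theory Defs
  imports "HOL-Analysis.Analysis"
begin

section \<open>Monotone operators and resolvents\<close>

text \<open>
  A set-valued operator on \<open>H\<close> is a function \<open>H \<Rightarrow> H set\<close>; its graph is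
  \<open>{(x, u). u \<in> A x}\<close>.  Maximality is with respect to graph inclusion.
\<close>

definition monotone_operator :: "('a::real_inner \<Rightarrow> 'a set) \<Rightarrow> bool" where
  "monotone_operator A \<longleftrightarrow>
     (\<forall>x y. \<forall>u\<in>A x. \<forall>v\<in>A y. 0 \<le> (x - y) \<bullet> (u - v))"

definition maximal_monotone :: "('a::real_inner \<Rightarrow> 'a set) \<Rightarrow> bool" where
  "maximal_monotone A \<longleftrightarrow>
     monotone_operator A \<and>
     (\<forall>A'. monotone_operator A' \<longrightarrow> (\<forall>x. A x \<subseteq> A' x) \<longrightarrow> A' = A)"

text \<open>
  \<open>resolvent \<gamma> A\<close> is \<open>(Id + \<gamma> A)\<^sup>-\<^sup>1\<close>, as a function.  If \<open>A\<close> is monotone and \<open>\<gamma> > 0\<close>, the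
  described \<open>p\<close> is unique; it exists for every \<open>w\<close> if moreover \<open>A\<close> is maximal monotone and the
  space is complete (Minty's theorem).
\<close>

definition resolvent :: "real \<Rightarrow> ('a::real_inner \<Rightarrow> 'a set) \<Rightarrow> 'a \<Rightarrow> 'a" where
  "resolvent \<gamma> A w = (THE p. w \<in> {p + \<gamma> *\<^sub>R u | u. u \<in> A p})"

definition reflected_resolvent :: "real \<Rightarrow> ('a::real_inner \<Rightarrow> 'a set) \<Rightarrow> 'a \<Rightarrow> 'a" where
  "reflected_resolvent \<gamma> A w = 2 *\<^sub>R resolvent \<gamma> A w - w"

definition Fix :: "('a \<Rightarrow> 'a) \<Rightarrow> 'a set" where
  "Fix T = {p. T p = p}"

section \<open>The rate functions\<close>

text \<open>
  All subtractions below are on natural numbers.  For \<open>N, l \<ge> 1\<close> and positive \<open>h\<close>, the only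
  arguments for which they are used, none of them truncates; likewise \<open>nat\<close> is only applied to
  positive integers.
\<close>

definition G_rate :: "nat \<Rightarrow> (nat \<Rightarrow> nat) \<Rightarrow> (nat \<Rightarrow> nat) \<Rightarrow> nat \<Rightarrow> nat" where
  "G_rate N B L k = max (B (4 * N * (k + 1) - 1)) (L (10 * N * (k + 1) - 1))"

definition nu1 ::
  "nat \<Rightarrow> (nat \<Rightarrow> nat) \<Rightarrow> (nat \<Rightarrow> nat) \<Rightarrow> (nat \<Rightarrow> nat) \<Rightarrow> nat \<Rightarrow> nat" where
  "nu1 N D B L k =
     (let M = max 0 (G_rate N B L (3 * k + 2) + 1)
      in D (M - 1 + nat \<lceil>ln (real (6 * N * (k + 1)))\<rceil>) + 1)"

definition nu2 ::
  "nat \<Rightarrow> nat \<Rightarrow> (nat \<Rightarrow> nat) \<Rightarrow> (nat \<Rightarrow> nat) \<Rightarrow> (nat \<Rightarrow> nat) \<Rightarrow> (nat \<Rightarrow> nat) \<Rightarrow> nat \<Rightarrow> nat" where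
  "nu2 N l b D B L k =
     max (b (4 * N * l * (k + 1) - 1)) (nu1 N D B L (2 * l * (k + 1) - 1))"

definition psi ::
  "nat \<Rightarrow> nat \<Rightarrow> (nat \<Rightarrow> nat) \<Rightarrow> (nat \<Rightarrow> nat) \<Rightarrow> (nat \<Rightarrow> nat) \<Rightarrow> (nat \<Rightarrow> nat) \<Rightarrow>
     nat \<Rightarrow> (nat \<Rightarrow> nat) \<Rightarrow> nat" where
  "psi N l b D B L k f =
     (let \<nu> = nu2 N l b D B L;
          g = (\<lambda>m. f (\<nu> m));
          R = 64 * N ^ 4 * (k + 1) ^ 2;
          g' = (\<lambda>m. max (g (48 * N * (m + 1) ^ 2)) (48 * N * (m + 1) ^ 2))
      in \<nu> (48 * N * ((g' ^^ R) 0 + 1) ^ 2))"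

definition sigma :: "nat \<Rightarrow> (nat \<Rightarrow> nat) \<Rightarrow> nat \<Rightarrow> nat \<Rightarrow> nat" where
  "sigma N D k n = D (n + nat \<lceil>ln (real (27 * N ^ 2 * (k + 1)))\<rceil>) + 1"

definition mu ::
  "nat \<Rightarrow> nat \<Rightarrow> (nat \<Rightarrow> nat) \<Rightarrow> (nat \<Rightarrow> nat) \<Rightarrow> (nat \<Rightarrow> nat) \<Rightarrow> (nat \<Rightarrow> nat) \<Rightarrow> (nat \<Rightarrow> nat) \<Rightarrow>
     nat \<Rightarrow> (nat \<Rightarrow> nat) \<Rightarrow> nat" where
  "mu N l b h D B L k f =
     (let k' = 4 * (k + 1) ^ 2 - 1;
          n\<^sub>1 = b (54 * N ^ 2 * (k' + 1) - 1);
          f\<^sub>1 = (\<lambda>m. f (sigma N D k' (max m n\<^sub>1)));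
          f\<^sub>2 = (\<lambda>m. 3 * (10 * N + 1) * (k' + 1) * (f\<^sub>1 m + 1) * h (f\<^sub>1 m) - 1)
      in sigma N D k' (max (psi N l b D B L (12 * (k' + 1) - 1) f\<^sub>2) n\<^sub>1))"

definition mu3 ::
  "nat \<Rightarrow> nat \<Rightarrow> (nat \<Rightarrow> nat) \<Rightarrow> (nat \<Rightarrow> nat) \<Rightarrow> (nat \<Rightarrow> nat) \<Rightarrow> (nat \<Rightarrow> nat) \<Rightarrow> (nat \<Rightarrow> nat) \<Rightarrow>
     nat \<Rightarrow> (nat \<Rightarrow> nat) \<Rightarrow> nat" where
  "mu3 N l b h D B L k f = mu N (2 * l) b h D B L k f"

definition mu4 ::
  "nat \<Rightarrow> nat \<Rightarrow> (nat \<Rightarrow> nat) \<Rightarrow> (nat \<Rightarrow> nat) \<Rightarrow> (nat \<Rightarrow> nat) \<Rightarrow> (nat \<Rightarrow> nat) \<Rightarrow> (nat \<Rightarrow> nat) \<Rightarrow>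
     nat \<Rightarrow> (nat \<Rightarrow> nat) \<Rightarrow> nat" where
  "mu4 N l b h D B L k f =
     (let g\<^sub>1 = (\<lambda>m. f (max m (b (8 * N * (k + 1) - 1))))
      in max (mu3 N l b h D B L (2 * k + 1) g\<^sub>1) (b (8 * N * (k + 1) - 1)))"

definition mu5 ::
  "nat \<Rightarrow> nat \<Rightarrow> (nat \<Rightarrow> nat) \<Rightarrow> (nat \<Rightarrow> nat) \<Rightarrow> (nat \<Rightarrow> nat) \<Rightarrow> (nat \<Rightarrow> nat) \<Rightarrow> (nat \<Rightarrow> nat) \<Rightarrow>
     nat \<Rightarrow> (nat \<Rightarrow> nat) \<Rightarrow> nat" where
  "mu5 N l b h D B L k f =
     (let c = max (nu1 N D B L (6 * l * (k + 1) - 1)) (b (12 * l * N * (k + 1) - 1));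
          g\<^sub>2 = (\<lambda>m. f (max m c))
      in max (mu4 N l b h D B L (3 * k + 2) g\<^sub>2) c)"

end

(*
  Put w_n = beta_n x_n and T = R_1 o R_2, where R_i is the reflected resolvent of T_i. By Minty's
  theorem T is nonexpansive on all of H, and the iteration reads x_{n+1} = w_n + (lambda_n/2) (T w_n - w_n).

  Minty's theorem is obtained by maximising the concave function t - |s|^2 over the convex hull of the
  points ((a - v)/2, -<a, v>), for (a, v) in the monotone graph: monotonicity makes the function
  nonpositive there, a maximising sequence is Cauchy in s, and its limit is the resolvent at 0.

  For the iteration, divergence of sum (1 - beta_n) and the Cauchy rates give x_{n+1} - x_n -> 0 and
  T w_n - w_n -> 0 with explicit rates. The projection of 0 onto Fix T is replaced by a point u that
  almost minimises the norm among approximate fixed points; u is found by letting the quality of the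
  approximate fixed points increase R times, so that the minimal norm squared, which is at most N^2,
  must grow by at most N^2/R in one of the steps. Then |x_{n+1} - u|^2 satisfies a contractive
  recursion up to small errors on the interval where closeness is required.
*)
theory Submission
  imports Defs
begin

section \<open>Minty's theorem\<close>

text \<open>Near-optimality of \<open>u\<close> along the segment to \<open>v\<close> turns the
  coefficient of \<open>t\<close> into a variational inequality.\<close>

lemma norm_convex_combination_square:
  fixes u v :: "'a::real_inner"
  shows "(norm ((1 - t) *\<^sub>R u + t *\<^sub>R v))\<^sup>2 = (norm u)\<^sup>2 + 2 * t * (u \<bullet> (v - u)) + t\<^sup>2 * (norm (v - u))\<^sup>2"
proof -
  have "(1 - t) *\<^sub>R u + t *\<^sub>R v = u + t *\<^sub>R (v - u)"
    by (simp add: algebra_simps)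
  moreover have "(norm (u + t *\<^sub>R (v - u)))\<^sup>2 = (norm u)\<^sup>2 + 2 * t * (u \<bullet> (v - u)) + t\<^sup>2 * (norm (v - u))\<^sup>2"
    unfolding power2_norm_eq_inner
    by (simp add: inner_add_left inner_add_right inner_commute[of "v - u" u] power2_eq_square distrib_left)
  ultimately show ?thesis
    by simp
qed

text \<open>First-order optimality for the concave function \<open>t - |s|^2\<close> on
  \<open>C\<close>: its affine majorant at a maximiser stays below the supremum
  \<open>m \<le> 0\<close>. As \<open>C\<close> need not be closed, \<open>p\<close> is obtained
  only as a limit of first components of a maximising sequence.\<close>

lemma convex_dual_point:
  fixes C :: "('a::{real_inner, complete_space} \<times> real) set"
  assumes C: "convex C" and nonpos: "\<And>s t. (s, t) \<in> C \<Longrightarrow> t \<le> (norm s)\<^sup>2"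
  obtains p where "\<And>s t. (s, t) \<in> C \<Longrightarrow> (norm p)\<^sup>2 - 2 * (p \<bullet> s) + t \<le> 0"
proof (cases "C = {}")
  case False
  define g :: "'a \<times> real \<Rightarrow> real" where "g c = snd c - (norm (fst c))\<^sup>2" for c
  define m where "m = (SUP c\<in>C. g c)"
  have g0: "g c \<le> 0" if "c \<in> C" for c
    using nonpos[of "fst c" "snd c"] that by (simp add: g_def)
  have bdd: "bdd_above (g ` C)"
    using g0 by (intro bdd_aboveI[of _ 0]) auto
  have gm: "g c \<le> m" if "c \<in> C" for c
    unfolding m_def using bdd that by (simp add: cSUP_upper)
  have m0: "m \<le> 0"
    unfolding m_def using False g0 by (intro cSUP_least) auto
  have "\<exists>c\<in>C. g c > m - 1 / (real n + 1)" for n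
    using less_cSUP_iff[OF False bdd, of "m - 1 / (real n + 1)"] by (simp add: m_def)
  then obtain c where c: "\<And>n. c n \<in> C" and cg: "\<And>n. g (c n) > m - 1 / (real n + 1)"
    by metis
  define s where "s n = fst (c n)" for n
  define t where "t n = snd (c n)" for n
  \<comment> \<open>Strong concavity in \<open>s\<close>: the midpoint of \<open>c i\<close> and
    \<open>c j\<close> lies in \<open>C\<close>, and by the parallelogram identity its value exceeds
    the average of the two values by \<open>|s i - s j|^2 / 4\<close>, yet is at most
    \<open>m\<close>.\<close>
  have close: "(norm (s i - s j))\<^sup>2 \<le> 2 / (real i + 1) + 2 / (real j + 1)" for i j
  proof -
    have "(1/2) *\<^sub>R c i + (1/2) *\<^sub>R c j \<in> C"
      using C c by (intro convexD) auto
    from gm[OF this]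
    have "(t i + t j) / 2 - (norm ((1/2) *\<^sub>R s i + (1/2) *\<^sub>R s j))\<^sup>2 \<le> m"
      by (simp add: g_def s_def t_def field_simps)
    moreover have "(norm ((1/2) *\<^sub>R s i + (1/2) *\<^sub>R s j))\<^sup>2
        = ((norm (s i))\<^sup>2 + (norm (s j))\<^sup>2) / 2 - (norm (s i - s j))\<^sup>2 / 4"
      by (simp add: power2_norm_eq_inner inner_simps inner_commute field_simps)
    moreover have "t i - (norm (s i))\<^sup>2 > m - 1 / (real i + 1)" "t j - (norm (s j))\<^sup>2 > m - 1 / (real j + 1)"
      using cg[of i] cg[of j] by (simp_all add: g_def s_def t_def)
    ultimately have "(norm (s i - s j))\<^sup>2 / 4 \<le> (1 / (real i + 1) + 1 / (real j + 1)) / 2"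
      by argo
    then show ?thesis by simp
  qed
  have "Cauchy s"
  proof (rule metric_CauchyI)
    fix e :: real assume e: "e > 0"
    obtain n0 :: nat where n0: "real n0 > 4 / e\<^sup>2"
      using reals_Archimedean2 by blast
    have "dist (s i) (s j) < e" if "i \<ge> n0" "j \<ge> n0" for i j
    proof -
      have bnd: "2 / (real k + 1) < e\<^sup>2 / 2" if "k \<ge> n0" for k
      proof -
        have "real k + 1 > 4 / e\<^sup>2"
          using n0 that by linarith
        then show ?thesis
          using e by (simp add: field_simps)
      qed
      have "(norm (s i - s j))\<^sup>2 < e\<^sup>2"
        using close[of i j] bnd[OF that(1)] bnd[OF that(2)] by linarith
      then show ?thesis
        using e by (simp add: dist_norm power2_less_imp_less)
    qed
    then show "\<exists>M. \<forall>i\<ge>M. \<forall>j\<ge>M. dist (s i) (s j) < e"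
      by blast
  qed
  then obtain p where p: "s \<longlonglongrightarrow> p"
    using Cauchy_convergent_iff convergent_def by blast
  have "(\<lambda>n. g (c n)) \<longlonglongrightarrow> m"
  proof (rule real_tendsto_sandwich)
    show "(\<lambda>n. m - 1 / (real n + 1)) \<longlonglongrightarrow> m"
      using tendsto_diff[OF tendsto_const LIMSEQ_inverse_real_of_nat, of m]
      by (simp add: inverse_eq_divide add.commute)
    show "\<forall>\<^sub>F n in sequentially. m - 1 / (real n + 1) \<le> g (c n)"
      using cg by (simp add: less_imp_le)
    show "\<forall>\<^sub>F n in sequentially. g (c n) \<le> m"
      using gm c by simp
  qed simp
  \<comment> \<open>The second components converge because \<open>t n\<close> is
    \<open>g (c n) + |s n|^2\<close>.\<close>
  from tendsto_add[OF this tendsto_power[OF tendsto_norm[OF p], of 2]]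
  have tlim: "t \<longlonglongrightarrow> m + (norm p)\<^sup>2"
    by (simp add: g_def s_def t_def[abs_def])
  have "(norm p)\<^sup>2 - 2 * (p \<bullet> s') + t' \<le> 0" if st: "(s', t') \<in> C" for s' t'
  proof -
    \<comment> \<open>The maximising sequence is mixed with \<open>(s', t')\<close>; first
      \<open>n\<close> tends to infinity, then \<open>e\<close> is divided out, and \<open>e\<close>
      tending to 0 finally removes the quadratic term.\<close>
    have le: "(norm p)\<^sup>2 - 2 * (p \<bullet> s') + t' \<le> m + e * (norm (s' - p))\<^sup>2" if e: "0 < e" "e \<le> 1" for e
    proof -
      have mem: "(1 - e) *\<^sub>R c n + e *\<^sub>R (s', t') \<in> C" for n
        using C c st e by (intro convexD) auto
      have "(1 - e) * t n + e * t' - (norm ((1 - e) *\<^sub>R s n + e *\<^sub>R s'))\<^sup>2 \<le> m" for n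
        using gm[OF mem[of n]] by (simp add: g_def s_def t_def)
      then have "(1 - e) * (m + (norm p)\<^sup>2) + e * t' - (norm ((1 - e) *\<^sub>R p + e *\<^sub>R s'))\<^sup>2 \<le> m"
        by (intro LIMSEQ_le_const2[where X = "\<lambda>n. (1 - e) * t n + e * t' - (norm ((1 - e) *\<^sub>R s n + e *\<^sub>R s'))\<^sup>2"])
          (auto intro!: tendsto_intros p tlim)
      then have "e * ((norm p)\<^sup>2 - 2 * (p \<bullet> s') + t') \<le> e * (m + e * (norm (s' - p))\<^sup>2)"
        unfolding norm_convex_combination_square
        by (simp add: inner_simps dot_square_norm algebra_simps power2_eq_square)
      then show ?thesis
        using e by simp
    qed
    have "((\<lambda>e. m + e * (norm (s' - p))\<^sup>2) \<longlongrightarrow> m + 0 * (norm (s' - p))\<^sup>2) (at_right 0)"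
      by (intro tendsto_intros)
    moreover have "\<forall>\<^sub>F e in at_right 0. (norm p)\<^sup>2 - 2 * (p \<bullet> s') + t' \<le> m + e * (norm (s' - p))\<^sup>2"
      unfolding eventually_at_right_field using le by (intro exI[of _ 1]) auto
    ultimately have "(norm p)\<^sup>2 - 2 * (p \<bullet> s') + t' \<le> m"
      by (intro tendsto_lowerbound) auto
    with m0 show ?thesis by simp
  qed
  then show ?thesis by (rule that)
qed (use that in auto)

text \<open>The form \<open>Q\<close> is symmetric, affine in each argument, and has diagonal value
  \<open>2 * (r - a \<bullet> v)\<close>. On two generators it equals
  \<open>(a - a') \<bullet> (v - v') \<ge> 0\<close>; this sign passes to the hull in one argument
  and then in the other.\<close>

lemma monotone_hull_inner_le:
  fixes G :: "('a::real_inner \<times> 'a) set"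
  assumes mono: "\<And>a v a' v'. (a, v) \<in> G \<Longrightarrow> (a', v') \<in> G \<Longrightarrow> 0 \<le> (a - a') \<bullet> (v - v')"
    and hull: "(a, v, r) \<in> convex hull ((\<lambda>(a, v). (a, v, a \<bullet> v)) ` G)" (is "_ \<in> convex hull ?S")
  shows "a \<bullet> v \<le> r"
proof -
  define Q where "Q = (\<lambda>(a::'a, v::'a, r::real) (a'::'a, v'::'a, r'::real). r + r' - a \<bullet> v' - a' \<bullet> v)"
  have affine: "Q d (s *\<^sub>R c + t *\<^sub>R c') = s * Q d c + t * Q d c'" if "s + t = 1" for d c c' s t
  proof -
    have s: "s = 1 - t" using that by simp
    show ?thesis
      unfolding s by (cases d; cases c; cases c') (simp add: Q_def inner_simps algebra_simps)
  qed
  have conv: "convex {c. 0 \<le> Q d c}" for d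
    by (rule convexI) (simp add: affine)
  have S: "0 \<le> Q d c" if "d \<in> ?S" "c \<in> convex hull ?S" for c d
  proof -
    have "convex hull ?S \<subseteq> {c. 0 \<le> Q d c}"
    proof (rule hull_minimal)
      show "?S \<subseteq> {c. 0 \<le> Q d c}"
        using that(1) mono by (fastforce simp: Q_def inner_simps algebra_simps)
    qed (rule conv)
    with that(2) show ?thesis by auto
  qed
  have Q_commute: "Q d c = Q c d" for c d
    by (simp add: Q_def split_beta)
  have "convex hull ?S \<subseteq> {c. 0 \<le> Q (a, v, r) c}"
  proof (rule hull_minimal)
    show "?S \<subseteq> {c. 0 \<le> Q (a, v, r) c}"
    proof
      fix c assume "c \<in> ?S"
      from S[OF this hull] show "c \<in> {c. 0 \<le> Q (a, v, r) c}"
        unfolding Q_commute[of "(a, v, r)"] by (rule CollectI)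
    qed
  qed (rule conv)
  from subsetD[OF this hull] have "0 \<le> Q (a, v, r) (a, v, r)"
    by (rule CollectD)
  then show ?thesis
    by (simp add: Q_def)
qed

text \<open>This is the resolvent equation at 0. On the hull \<open>r \<ge> a \<bullet> v\<close>,
  and \<open>|(a - v)/2|^2 + a \<bullet> v = |(a + v)/2|^2\<close>, so the image under
  \<open>F\<close> meets the sign condition of \<open>convex_dual_point\<close>; at the generators
  the resulting inequality is the claim.\<close>

lemma monotone_graph_extension:
  fixes G :: "('a::{real_inner, complete_space} \<times> 'a) set"
  assumes mono: "\<And>a v a' v'. (a, v) \<in> G \<Longrightarrow> (a', v') \<in> G \<Longrightarrow> 0 \<le> (a - a') \<bullet> (v - v')"
  obtains p where "\<And>a v. (a, v) \<in> G \<Longrightarrow> 0 \<le> (p - a) \<bullet> (- p - v)"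
proof -
  define K where "K = convex hull ((\<lambda>(a, v). (a, v, a \<bullet> v)) ` G)"
  define F :: "'a \<times> 'a \<times> real \<Rightarrow> 'a \<times> real" where "F = (\<lambda>(a, v, r). ((1/2) *\<^sub>R (a - v), - r))"
  have "linear F"
    by (rule linearI) (auto simp: F_def algebra_simps)
  then have "convex (F ` K)"
    by (simp add: K_def convex_linear_image)
  moreover have "t \<le> (norm s)\<^sup>2" if st: "(s, t) \<in> F ` K" for s t
  proof -
    obtain c where c: "c \<in> K" "(s, t) = F c"
      using st by blast
    obtain a v r where avr: "c = (a, v, r)"
      by (cases c)
    have K: "(a, v, r) \<in> K" and s: "s = (1/2) *\<^sub>R (a - v)" and t: "t = - r"
      using c by (simp_all add: avr F_def)
    have "a \<bullet> v \<le> r"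
      using monotone_hull_inner_le[OF mono] K by (auto simp: K_def)
    moreover have "(norm s)\<^sup>2 + a \<bullet> v = (norm ((1/2) *\<^sub>R (a + v)))\<^sup>2"
      by (simp add: s power2_norm_eq_inner inner_simps inner_commute field_simps)
    ultimately show ?thesis
      using zero_le_power2[of "norm ((1/2) *\<^sub>R (a + v))"] t by linarith
  qed
  ultimately obtain p where p: "\<And>s t. (s, t) \<in> F ` K \<Longrightarrow> (norm p)\<^sup>2 - 2 * (p \<bullet> s) + t \<le> 0"
    using convex_dual_point by blast
  have "0 \<le> (p - a) \<bullet> (- p - v)" if "(a, v) \<in> G" for a v
  proof -
    have "(a, v, a \<bullet> v) \<in> K"
      using that by (auto simp: K_def intro!: hull_inc)
    then have "F (a, v, a \<bullet> v) \<in> F ` K" by blast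
    then show ?thesis
      using p[of "(1/2) *\<^sub>R (a - v)" "- (a \<bullet> v)"]
      by (simp add: F_def power2_norm_eq_inner inner_simps inner_commute algebra_simps)
  qed
  then show ?thesis by (rule that)
qed

theorem minty:
  fixes A :: "'a::{real_inner, complete_space} \<Rightarrow> 'a set"
  assumes max: "maximal_monotone A" and "\<gamma> > 0"
  shows "\<exists>p. \<exists>u\<in>A p. w = p + \<gamma> *\<^sub>R u"
proof -
  have A: "0 \<le> (a - a') \<bullet> (u - u')" if "u \<in> A a" "u' \<in> A a'" for a a' u u'
    using max that by (auto simp: maximal_monotone_def monotone_operator_def)
  \<comment> \<open>Scaling by \<open>\<gamma>\<close> and shifting by \<open>w\<close> moves the
    problem to 0: with \<open>q\<close> as below,
    \<open>\<gamma> *\<^sub>R q - w = - p\<close>.\<close>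
  define G where "G = {(a, \<gamma> *\<^sub>R u - w) | a u. u \<in> A a}"
  have "0 \<le> (a - a') \<bullet> (v - v')" if G: "(a, v) \<in> G" "(a', v') \<in> G" for a v a' v'
  proof -
    obtain u u' where u: "u \<in> A a" "u' \<in> A a'" "v = \<gamma> *\<^sub>R u - w" "v' = \<gamma> *\<^sub>R u' - w"
      using G by (auto simp: G_def)
    have "(a - a') \<bullet> (v - v') = \<gamma> * ((a - a') \<bullet> (u - u'))"
      unfolding u(3,4) by (simp add: inner_simps algebra_simps)
    then show ?thesis
      using A[OF u(1,2)] \<open>\<gamma> > 0\<close> by simp
  qed
  then obtain p where p: "\<And>a v. (a, v) \<in> G \<Longrightarrow> 0 \<le> (p - a) \<bullet> (- p - v)"
    using monotone_graph_extension by blast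
  define q where "q = (1 / \<gamma>) *\<^sub>R (w - p)"
  have pq: "0 \<le> (p - a) \<bullet> (q - u)" if "u \<in> A a" for a u
  proof -
    have "(p - a) \<bullet> (- p - (\<gamma> *\<^sub>R u - w)) = \<gamma> * ((p - a) \<bullet> (q - u))"
      using \<open>\<gamma> > 0\<close> by (simp add: q_def inner_simps field_simps)
    moreover have "0 \<le> (p - a) \<bullet> (- p - (\<gamma> *\<^sub>R u - w))"
      using that by (intro p) (auto simp: G_def)
    ultimately show ?thesis
      using \<open>\<gamma> > 0\<close> by (simp add: zero_le_mult_iff)
  qed
  have qp: "0 \<le> (a - p) \<bullet> (u - q)" if "u \<in> A a" for a u
    using pq[OF that] by (simp add: inner_simps algebra_simps)
  \<comment> \<open>Adding the pair \<open>(p, q)\<close> to the graph keeps it monotone, so by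
    maximality it was there already.\<close>
  have "monotone_operator (A(p := insert q (A p)))"
    unfolding monotone_operator_def using A pq qp by (auto simp: fun_upd_def)
  then have "A(p := insert q (A p)) = A"
    using max by (auto simp: maximal_monotone_def)
  then have "q \<in> A p"
    by (metis fun_upd_same insertI1)
  moreover have "w = p + \<gamma> *\<^sub>R q"
    using \<open>\<gamma> > 0\<close> by (simp add: q_def)
  ultimately show ?thesis by blast
qed

section \<open>Resolvents and reflected resolvents of maximal monotone operators\<close>

lemma resolvent_firmly_nonexpansive:
  fixes A :: "'a::{real_inner, complete_space} \<Rightarrow> 'a set"
  assumes max: "maximal_monotone A" and "\<gamma> > 0"
  defines "J \<equiv> resolvent \<gamma> A"
  shows "(norm (J v - J w))\<^sup>2 \<le> (J v - J w) \<bullet> (v - w)"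
proof -
  \<comment> \<open>Stated for arbitrary solutions rather than for \<open>J\<close>, so that
    \<open>v = w\<close> gives the uniqueness needed to unfold the definite description; existence
    is Minty's theorem.\<close>
  have firm: "(norm (p - q))\<^sup>2 \<le> (p - q) \<bullet> (v - w)"
    if "u \<in> A p" "u' \<in> A q" "v = p + \<gamma> *\<^sub>R u" "w = q + \<gamma> *\<^sub>R u'" for p q u u' v w
  proof -
    have "0 \<le> (p - q) \<bullet> (u - u')"
      using max that by (auto simp: maximal_monotone_def monotone_operator_def)
    then have "0 \<le> \<gamma> * ((p - q) \<bullet> (u - u'))"
      using \<open>\<gamma> > 0\<close> by simp
    then show ?thesis
      using that by (simp add: power2_norm_eq_inner inner_simps algebra_simps)
  qed
  have J: "\<exists>u\<in>A (J w). w = J w + \<gamma> *\<^sub>R u" for w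
  proof -
    have "\<exists>p. w \<in> {p + \<gamma> *\<^sub>R u | u. u \<in> A p}"
      using minty[OF assms(1,2), of w] by blast
    moreover have "p = q"
      if "w \<in> {p + \<gamma> *\<^sub>R u | u. u \<in> A p}" "w \<in> {q + \<gamma> *\<^sub>R u | u. u \<in> A q}" for p q
    proof -
      obtain u u' where "u \<in> A p" "u' \<in> A q" "w = p + \<gamma> *\<^sub>R u" "w = q + \<gamma> *\<^sub>R u'"
        using \<open>w \<in> {p + \<gamma> *\<^sub>R u | u. u \<in> A p}\<close> \<open>w \<in> {q + \<gamma> *\<^sub>R u | u. u \<in> A q}\<close> by blast
      then have "(norm (p - q))\<^sup>2 \<le> (p - q) \<bullet> (w - w)"
        by (rule firm)
      then show ?thesis by simp
    qed
    ultimately have "\<exists>!p. w \<in> {p + \<gamma> *\<^sub>R u | u. u \<in> A p}"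
      by (intro ex_ex1I)
    then have "w \<in> {J w + \<gamma> *\<^sub>R u | u. u \<in> A (J w)}"
      unfolding J_def resolvent_def by (rule theI')
    then show ?thesis by blast
  qed
  show ?thesis
    using J[of v] J[of w] by (auto intro: firm)
qed

lemma resolvent_nonexpansive:
  fixes A :: "'a::{real_inner, complete_space} \<Rightarrow> 'a set"
  assumes "maximal_monotone A" and "\<gamma> > 0"
  shows "norm (resolvent \<gamma> A v - resolvent \<gamma> A w) \<le> norm (v - w)"
proof -
  let ?d = "resolvent \<gamma> A v - resolvent \<gamma> A w"
  have "norm ?d * norm ?d \<le> norm ?d * norm (v - w)"
    using resolvent_firmly_nonexpansive[OF assms, of v w] norm_cauchy_schwarz[of ?d "v - w"]
    by (simp add: power2_eq_square)
  then show ?thesis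
    by (cases "?d = 0") auto
qed

text \<open>Expanding the square of \<open>2 *\<^sub>R ?d - (v - w)\<close> leaves
  \<open>|v - w|^2\<close> plus four times the quantity that firm nonexpansiveness makes
  nonpositive.\<close>

lemma reflected_resolvent_nonexpansive:
  fixes A :: "'a::{real_inner, complete_space} \<Rightarrow> 'a set"
  assumes "maximal_monotone A" and "\<gamma> > 0"
  shows "norm (reflected_resolvent \<gamma> A v - reflected_resolvent \<gamma> A w) \<le> norm (v - w)"
proof -
  let ?d = "resolvent \<gamma> A v - resolvent \<gamma> A w"
  have "reflected_resolvent \<gamma> A v - reflected_resolvent \<gamma> A w = 2 *\<^sub>R ?d - (v - w)"
    by (simp add: reflected_resolvent_def scaleR_diff_right)
  moreover have "(norm (2 *\<^sub>R ?d - (v - w)))\<^sup>2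
      = (norm (v - w))\<^sup>2 + 4 * ((norm ?d)\<^sup>2 - ?d \<bullet> (v - w))"
    unfolding power2_norm_eq_inner
    by (simp add: inner_diff_left[of "2 *\<^sub>R ?d"] inner_diff_right[of _ "2 *\<^sub>R ?d"] inner_commute)
  ultimately have "(norm (reflected_resolvent \<gamma> A v - reflected_resolvent \<gamma> A w))\<^sup>2 \<le> (norm (v - w))\<^sup>2"
    using resolvent_firmly_nonexpansive[OF assms, of v w] by simp
  then show ?thesis
    by (rule power2_le_imp_le) simp
qed

section \<open>Approximate projection onto the fixed point set\<close>

lemma norm_diff_convex_combination_square:
  fixes v x y :: "'a::real_inner"
  shows "(norm (v - ((1 - t) *\<^sub>R x + t *\<^sub>R y)))\<^sup>2
    = (1 - t) * (norm (v - x))\<^sup>2 + t * (norm (v - y))\<^sup>2 - t * (1 - t) * (norm (y - x))\<^sup>2"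
  unfolding power2_norm_eq_inner
  by (simp add: inner_simps inner_commute algebra_simps power2_eq_square)

text \<open>Approximate fixed points form an almost convex set. \<open>T z\<close> is within
  \<open>t * \<delta> + e\<close> of \<open>x\<close> and \<open>(1 - t) * \<delta> + e\<close> of
  \<open>y\<close>; in the identity for the squared distance to a point of the segment the terms in
  \<open>\<delta>^2\<close> cancel, leaving
  \<open>4 * t * (1 - t) * \<delta> * e + e^2\<close>.\<close>

lemma nonexpansive_convex_combination:
  fixes T :: "'a::real_inner \<Rightarrow> 'a"
  assumes nonexp: "\<And>u v. norm (T u - T v) \<le> norm (u - v)"
    and x: "norm (T x - x) \<le> e" and y: "norm (T y - y) \<le> e"
    and d: "norm (y - x) \<le> d" and t: "0 \<le> t" "t \<le> 1"
  defines "z \<equiv> (1 - t) *\<^sub>R x + t *\<^sub>R y"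
  shows "(norm (T z - z))\<^sup>2 \<le> d * e + e\<^sup>2"
proof -
  define \<delta> where "\<delta> = norm (y - x)"
  have e: "0 \<le> e" using x norm_ge_zero order_trans by blast
  have "z - x = t *\<^sub>R (y - x)" "z - y = (t - 1) *\<^sub>R (y - x)"
    by (simp_all add: z_def algebra_simps)
  then have zx: "norm (z - x) = t * \<delta>" and zy: "norm (z - y) = (1 - t) * \<delta>"
    using t by (simp_all add: \<delta>_def)
  have 1: "norm (T z - x) \<le> t * \<delta> + e"
    using nonexp[of z x] x norm_triangle_ineq[of "T z - T x" "T x - x"] zx by simp
  have 2: "norm (T z - y) \<le> (1 - t) * \<delta> + e"
    using nonexp[of z y] y norm_triangle_ineq[of "T z - T y" "T y - y"] zy by simp
  have "(norm (T z - z))\<^sup>2 \<le> (1 - t) * (t * \<delta> + e)\<^sup>2 + t * ((1 - t) * \<delta> + e)\<^sup>2 - t * (1 - t) * \<delta>\<^sup>2"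
    unfolding z_def norm_diff_convex_combination_square \<delta>_def[symmetric]
    using t by (intro diff_right_mono add_mono mult_left_mono power_mono 1[unfolded z_def] 2[unfolded z_def]) auto
  also have "\<dots> = 4 * (t * (1 - t)) * (\<delta> * e) + e\<^sup>2"
    by (simp add: algebra_simps power2_eq_square)
  also have "\<dots> \<le> 1 * (d * e) + e\<^sup>2"
  proof -
    have "4 * (t * (1 - t)) = 1 - (2 * t - 1)\<^sup>2"
      by (simp add: algebra_simps power2_eq_square)
    then have "4 * (t * (1 - t)) \<le> 1"
      by simp
    moreover have "\<delta> * e \<le> d * e"
      using d e by (simp add: \<delta>_def mult_right_mono)
    moreover have "4 * (t * (1 - t)) * (\<delta> * e) \<le> 1 * (\<delta> * e)"
      using calculation(1) e by (intro mult_right_mono) (auto simp: \<delta>_def)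
    ultimately show ?thesis
      by linarith
  qed
  finally show ?thesis by simp
qed

lemma bounded_increments_small_step:
  fixes v :: "nat \<Rightarrow> real"
  assumes "0 < R" and "v R - v 0 \<le> c"
  shows "\<exists>i<R. v (Suc i) - v i \<le> c / real R"
proof (rule ccontr)
  assume "\<not> ?thesis"
  then have "(\<Sum>i<R. c / real R) < (\<Sum>i<R. v (Suc i) - v i)"
    using \<open>0 < R\<close> by (intro sum_strict_mono) (auto simp: not_le)
  then show False
    using assms by (simp add: sum_lessThan_telescope)
qed

lemma funpow_inflationary_mono:
  fixes g :: "nat \<Rightarrow> nat"
  assumes "\<And>m. m \<le> g m" and "i \<le> j"
  shows "(g ^^ i) 0 \<le> (g ^^ j) 0"
  using \<open>i \<le> j\<close> by (induction rule: dec_induct) (use assms(1) order_trans in auto)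

text \<open>A finitary substitute for the projection of 0 onto the fixed point set. The tolerance
  \<open>g n\<close> of \<open>u\<close> may depend on the tolerance \<open>n\<close> of its
  competitors \<open>w\<close>, so \<open>n\<close> is found by a pigeonhole argument over
  \<open>R\<close> successive refinements.\<close>

lemma approximate_projection:
  fixes T :: "'a::real_inner \<Rightarrow> 'a" and N k :: nat and g :: "nat \<Rightarrow> nat"
  assumes nonexp: "\<And>u v. norm (T u - T v) \<le> norm (u - v)"
    and fixp: "T p = p" and N: "norm p \<le> real N" and "0 < N"
  defines "g' \<equiv> \<lambda>m. max (g (48 * N * (m + 1) ^ 2)) (48 * N * (m + 1) ^ 2)"
  shows "\<exists>n \<le> 48 * N * ((g' ^^ (64 * N ^ 4 * (k + 1) ^ 2)) 0 + 1) ^ 2. \<exists>u.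
    norm (u - p) \<le> real N \<and> norm (T u - u) \<le> 1 / (real (g n) + 1) \<and>
    (\<forall>w. norm (w - p) \<le> real N \<longrightarrow> norm (T w - w) \<le> 1 / (real n + 1) \<longrightarrow>
      u \<bullet> (u - w) \<le> 1 / (2 * (real k + 1)))"
proof -
  define R where "R = 64 * N ^ 4 * (k + 1) ^ 2"
  define m where "m i = (g' ^^ i) 0" for i
  define A where "A i = {u. norm (u - p) \<le> real N \<and> norm (T u - u) \<le> 1 / (real (m i) + 1)}" for i
  define v where "v i = (INF u\<in>A i. (norm u)\<^sup>2)" for i
  have "0 < R" using \<open>0 < N\<close> by (simp add: R_def)
  have pA: "p \<in> A i" for i
    using fixp by (simp add: A_def)
  have bdd: "bdd_below ((\<lambda>u. (norm u)\<^sup>2) ` A i)" for i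
    by (intro bdd_belowI[of _ 0]) auto
  have v_le: "v i \<le> (norm u)\<^sup>2" if "u \<in> A i" for i u
    unfolding v_def using that bdd by (intro cINF_lower) auto
  have "0 \<le> v i" for i
    unfolding v_def using pA by (intro cINF_greatest) auto
  moreover have "v R \<le> (real N)\<^sup>2"
    using v_le[OF pA, of R] power_mono[OF N norm_ge_zero, of 2] by linarith
  ultimately have "v R - v 0 \<le> (real N)\<^sup>2"
    by (smt (verit))
  \<comment> \<open>The infima lie between 0 and \<open>N^2\<close>, so one of the \<open>R\<close>
    increments is at most \<open>N^2 / R\<close>; \<open>R\<close> is chosen to make this
    \<open>(\<eta> / 2)^2\<close> for the \<open>\<eta>\<close> below.\<close>
  then obtain i where i: "i < R" "v (Suc i) - v i \<le> (real N)\<^sup>2 / real R"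
    using bounded_increments_small_step[OF \<open>0 < R\<close>] by blast
  define n where "n = 48 * N * (m i + 1) ^ 2"
  define \<eta> where "\<eta> = 1 / (4 * real N * (real k + 1))"
  have N1: "1 \<le> real N" using \<open>0 < N\<close> by simp
  have \<eta>: "0 < \<eta>" using N1 by (simp add: \<eta>_def)
  have R_eq: "(real N)\<^sup>2 / real R = \<eta>\<^sup>2 / 4"
  proof -
    have "real R = (real N)\<^sup>2 * (8 * real N * (real k + 1))\<^sup>2"
      by (simp add: R_def power4_eq_xxxx power2_eq_square algebra_simps)
    then have "(real N)\<^sup>2 / real R = (1 / (8 * real N * (real k + 1)))\<^sup>2"
      using N1 by (simp add: power_divide)
    moreover have "1 / (8 * real N * (real k + 1)) = \<eta> / 2"
      by (simp add: \<eta>_def)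
    ultimately show ?thesis
      by (simp add: power_divide)
  qed
  have "v (Suc i) < v (Suc i) + \<eta>\<^sup>2 / 4"
    using \<eta> by simp
  then obtain u where u: "u \<in> A (Suc i)" and "(norm u)\<^sup>2 < v (Suc i) + \<eta>\<^sup>2 / 4"
    using cINF_less_iff[OF _ bdd, of "Suc i"] pA unfolding v_def[symmetric] by blast
  then have u_min: "(norm u)\<^sup>2 \<le> v i + \<eta>\<^sup>2"
    using i R_eq \<eta> zero_le_power2[of \<eta>] by linarith
  \<comment> \<open>The maximum in \<open>g'\<close> makes \<open>u\<close> meet two tolerances:
    \<open>g n\<close> for the conclusion and \<open>n\<close> for mixing with
    \<open>w\<close>.\<close>
  have mSuc: "m (Suc i) = max (g n) n"
    by (simp add: m_def g'_def n_def)
  have uN: "norm (u - p) \<le> real N" and Tu: "norm (T u - u) \<le> 1 / (real (m (Suc i)) + 1)"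
    using u by (auto simp: A_def)
  have frac: "1 / (real (m (Suc i)) + 1) \<le> 1 / (real j + 1)" if "j \<le> m (Suc i)" for j
    using that by (simp add: frac_le)
  have infl: "j \<le> g' j" for j
  proof -
    have "1 * j \<le> 48 * N * (j + 1) ^ 2"
      using \<open>0 < N\<close> by (intro mult_le_mono) (auto simp: power2_eq_square)
    then show ?thesis by (simp add: g'_def)
  qed
  have "m i \<le> (g' ^^ R) 0"
    unfolding m_def using i by (intro funpow_inflationary_mono infl) auto
  then have "n \<le> 48 * N * ((g' ^^ R) 0 + 1) ^ 2"
    unfolding n_def by (intro mult_le_mono power_mono) auto
  moreover have "u \<bullet> (u - w) \<le> 1 / (2 * (real k + 1))"
    if wN: "norm (w - p) \<le> real N" and Tw: "norm (T w - w) \<le> 1 / (real n + 1)" for w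
  proof -
    have d: "norm (w - u) \<le> 2 * real N"
      using norm_triangle_ineq4[of "w - p" "u - p"] uN wN by simp
    \<comment> \<open>This choice balances the two errors below: \<open>\<eta>^2\<close> and
      \<open>t^2 * (2 * N)^2\<close> coincide.\<close>
    define t where "t = \<eta> / (2 * real N)"
    have "1 * 1 \<le> real N * (real k + 1)"
      using N1 by (intro mult_mono) auto
    then have "\<eta> \<le> 1"
      by (simp add: \<eta>_def)
    then have t: "0 < t" "t \<le> 1"
      using \<eta> N1 by (auto simp: t_def field_simps)
    define z where "z = (1 - t) *\<^sub>R u + t *\<^sub>R w"
    have "z - p = (1 - t) *\<^sub>R (u - p) + t *\<^sub>R (w - p)"
      by (simp add: z_def algebra_simps)
    then have "norm (z - p) \<le> (1 - t) * norm (u - p) + t * norm (w - p)"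
      using norm_triangle_ineq[of "(1 - t) *\<^sub>R (u - p)" "t *\<^sub>R (w - p)"] t by simp
    also have "\<dots> \<le> (1 - t) * real N + t * real N"
      using t uN wN by (intro add_mono mult_left_mono) auto
    finally have zN: "norm (z - p) \<le> real N"
      by (simp add: algebra_simps)
    have Tu': "norm (T u - u) \<le> 1 / (real n + 1)"
      using Tu frac[of n] mSuc by simp
    have "(norm (T z - z))\<^sup>2 \<le> 2 * real N * (1 / (real n + 1)) + (1 / (real n + 1))\<^sup>2"
      unfolding z_def using t by (intro nonexpansive_convex_combination nonexp Tu' Tw d) auto
    \<comment> \<open>\<open>n\<close> is a large enough multiple of \<open>N * (m i + 1)^2\<close>
      for each summand to be at most half of the right side. So mixing weakens the tolerance no
      further than to \<open>m i\<close>, and \<open>z\<close> belongs to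
      \<open>A i\<close>.\<close>
    also have "\<dots> \<le> (1 / (real (m i) + 1))\<^sup>2"
    proof -
      define q where "q = real (m i) + 1"
      have q: "q \<ge> 1" by (simp add: q_def)
      have "4 * real N * q\<^sup>2 \<le> real n + 1" "2 * q\<^sup>2 \<le> real n + 1"
      proof -
        have n: "real n = 48 * real N * q\<^sup>2"
          by (simp add: n_def q_def)
        have "1 * q\<^sup>2 \<le> real N * q\<^sup>2"
          using N1 by (intro mult_right_mono) auto
        then show "4 * real N * q\<^sup>2 \<le> real n + 1" "2 * q\<^sup>2 \<le> real n + 1"
          unfolding n using zero_le_power2[of q] by linarith+
      qed
      then have "2 * real N * (1 / (real n + 1)) \<le> 1 / (2 * q\<^sup>2)" "1 / (real n + 1) \<le> 1 / (2 * q\<^sup>2)"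
        using q by (simp_all add: field_simps)
      moreover have "(1 / (real n + 1))\<^sup>2 \<le> 1 / (real n + 1)"
        using power_decreasing[of 1 2 "1 / (real n + 1)"] by simp
      ultimately have "2 * real N * (1 / (real n + 1)) + (1 / (real n + 1))\<^sup>2 \<le> 1 / (2 * q\<^sup>2) + 1 / (2 * q\<^sup>2)"
        by linarith
      also have "\<dots> = (1 / q)\<^sup>2"
        by (simp add: power_divide)
      finally show ?thesis by (simp add: q_def)
    qed
    finally have "norm (T z - z) \<le> 1 / (real (m i) + 1)"
      by (rule power2_le_imp_le) simp
    with zN have "z \<in> A i"
      by (simp add: A_def)
    then have "(norm u)\<^sup>2 - \<eta>\<^sup>2 \<le> (norm z)\<^sup>2"
      using v_le u_min by fastforce
    then have "2 * t * (u \<bullet> (u - w)) \<le> \<eta>\<^sup>2 + t\<^sup>2 * (norm (w - u))\<^sup>2"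
      unfolding z_def norm_convex_combination_square by (simp add: inner_diff_right algebra_simps)
    also have "\<dots> \<le> \<eta>\<^sup>2 + t\<^sup>2 * (2 * real N)\<^sup>2"
      using d by (intro add_left_mono mult_left_mono power_mono) auto
    also have "\<dots> = 2 * t * (2 * real N * \<eta>)"
      using N1 by (simp add: t_def power2_eq_square)
    finally have "u \<bullet> (u - w) \<le> 2 * real N * \<eta>"
      using t by (simp add: mult_ac)
    also have "\<eta> = 1 / (2 * (real k + 1)) / (2 * real N)"
      by (simp add: \<eta>_def algebra_simps)
    also have "2 * real N * \<dots> = 1 / (2 * (real k + 1))"
      using N1 by (simp del: of_nat_Suc)
    finally show ?thesis .
  qed
  moreover have "norm (T u - u) \<le> 1 / (real (g n) + 1)"
    using Tu frac[of "g n"] mSuc by simp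
  ultimately show ?thesis
    using uN unfolding R_def by blast
qed

section \<open>Recursive inequalities\<close>

text \<open>In the induction \<open>\<beta> (Suc n)\<close> extends the product but is bounded by 1
  on the accumulated errors, which therefore just add up. \<open>s\<close> may be negative, as with
  the shifted squared distance used later.\<close>

lemma contractive_recursion_bound:
  fixes s \<beta> c :: "nat \<Rightarrow> real"
  assumes step: "\<And>j. m \<le> j \<Longrightarrow> j \<le> n \<Longrightarrow> s (Suc j) \<le> \<beta> j * s j + c j"
    and \<beta>: "\<And>j. 0 \<le> \<beta> j" "\<And>j. \<beta> j \<le> 1" and c: "\<And>j. 0 \<le> c j" and "m \<le> n"
  shows "s (Suc n) \<le> (\<Prod>i=m..n. \<beta> i) * s m + (\<Sum>i=m..n. c i)"
  using \<open>m \<le> n\<close> step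
proof (induction n rule: dec_induct)
  case base
  then show ?case by simp
next
  case (step n)
  have "s (Suc (Suc n)) \<le> \<beta> (Suc n) * s (Suc n) + c (Suc n)"
    using step by simp
  also have "\<dots> \<le> \<beta> (Suc n) * ((\<Prod>i=m..n. \<beta> i) * s m + (\<Sum>i=m..n. c i)) + c (Suc n)"
    using step \<beta> by (intro add_right_mono mult_left_mono) auto
  also have "\<dots> = (\<Prod>i=m..Suc n. \<beta> i) * s m + \<beta> (Suc n) * (\<Sum>i=m..n. c i) + c (Suc n)"
    using step by (simp add: algebra_simps prod.nat_ivl_Suc')
  also have "\<dots> \<le> (\<Prod>i=m..Suc n. \<beta> i) * s m + 1 * (\<Sum>i=m..n. c i) + c (Suc n)"
    using \<beta> c by (intro add_mono mult_right_mono order_refl sum_nonneg) auto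
  finally show ?case
    using step by simp
qed

text \<open>Since \<open>\<beta> i \<le> exp (- (1 - \<beta> i))\<close>, it suffices that the tail
  sum from \<open>m\<close> is at least \<open>ln c\<close>. The sum up to
  \<open>D (m' + nat \<lceil>ln c\<rceil>)\<close> is at least \<open>m' + ln c\<close>, and the
  indices from 1 to \<open>m - 1\<close> contribute at most \<open>m'\<close> of it.\<close>

lemma prod_le_inverse_of_divergence:
  fixes \<beta> :: "nat \<Rightarrow> real" and D :: "nat \<Rightarrow> nat"
  assumes \<beta>: "\<And>j. 0 \<le> \<beta> j" "\<And>j. \<beta> j \<le> 1"
    and D: "\<And>k. real k \<le> (\<Sum>i=1..D k. 1 - \<beta> i)"
    and "m \<le> Suc m'" and "0 < c" and n: "D (m' + nat \<lceil>ln c\<rceil>) \<le> n"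
  shows "(\<Prod>i=m..n. \<beta> i) \<le> 1 / c"
proof -
  let ?q = "m' + nat \<lceil>ln c\<rceil>"
  have "real ?q \<le> (\<Sum>i=1..D ?q. 1 - \<beta> i)"
    by (rule D)
  also have "\<dots> \<le> (\<Sum>i\<in>{1..<m} \<union> {m..n}. 1 - \<beta> i)"
    using n \<beta> by (intro sum_mono2) auto
  also have "\<dots> = (\<Sum>i=1..<m. 1 - \<beta> i) + (\<Sum>i=m..n. 1 - \<beta> i)"
    by (intro sum.union_disjoint) auto
  also have "(\<Sum>i=1..<m. 1 - \<beta> i) \<le> (\<Sum>i=1..<m. 1)"
    using \<beta> by (intro sum_mono) auto
  also have "\<dots> \<le> real m'"
    using \<open>m \<le> Suc m'\<close> by simp
  finally have "ln c \<le> (\<Sum>i=m..n. 1 - \<beta> i)"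
    by linarith
  have "(\<Prod>i=m..n. \<beta> i) \<le> (\<Prod>i=m..n. exp (- (1 - \<beta> i)))"
    using \<beta> exp_ge_add_one_self[of "- (1 - \<beta> _)"] by (intro prod_mono) auto
  also have "\<dots> = exp (- (\<Sum>i=m..n. 1 - \<beta> i))"
    by (simp add: exp_sum[symmetric] sum_negf[symmetric])
  also have "\<dots> \<le> exp (- ln c)"
    using \<open>ln c \<le> _\<close> by simp
  also have "\<dots> = 1 / c"
    using \<open>0 < c\<close> by (simp add: exp_minus inverse_eq_divide)
  finally show ?thesis .
qed

section \<open>The regularised iteration\<close>

text \<open>Rates are evaluated at predecessors \<open>q - 1\<close>, so that the accuracy becomes
  exactly \<open>1 / q\<close>.\<close>

lemma real_pred_plus_1: "0 < m \<Longrightarrow> real (m - 1) + 1 = real m"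
  by simp

lemma tail_sum_le:
  fixes d :: "nat \<Rightarrow> real" and B :: "nat \<Rightarrow> nat"
  assumes "\<And>k n. (\<Sum>i=B k + 1..B k + n. \<bar>d i\<bar>) \<le> 1 / (real k + 1)"
    and "B (q - 1) \<le> G" and "0 < q"
  shows "(\<Sum>i=Suc G..n. \<bar>d i\<bar>) \<le> 1 / real q"
proof -
  have "(\<Sum>i=Suc G..n. \<bar>d i\<bar>) \<le> (\<Sum>i=B (q - 1) + 1..B (q - 1) + n. \<bar>d i\<bar>)"
    using assms(2) by (intro sum_mono2) auto
  also have "\<dots> \<le> 1 / real q"
    using assms(1)[of "q - 1" n] unfolding real_pred_plus_1[OF \<open>0 < q\<close>] .
  finally show ?thesis .
qed

section \<open>Monotonicity of the rate functions\<close>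

lemma G_rate_mono:
  assumes "mono B" "mono L" "k \<le> k'"
  shows "G_rate N B L k \<le> G_rate N B L k'"
  unfolding G_rate_def
  using assms by (intro max.mono monoD[OF \<open>mono B\<close>] monoD[OF \<open>mono L\<close>] diff_le_mono mult_le_mono) auto

lemma nat_ceiling_ln_mono:
  assumes "0 < m" "m \<le> m'"
  shows "nat \<lceil>ln (real m)\<rceil> \<le> nat \<lceil>ln (real m')\<rceil>"
  using assms by (intro nat_mono ceiling_mono) simp

lemma nu1_mono:
  assumes "mono D" "mono B" "mono L" "0 < N" "k \<le> k'"
  shows "nu1 N D B L k \<le> nu1 N D B L k'"
proof -
  have "G_rate N B L (3 * k + 2) \<le> G_rate N B L (3 * k' + 2)"
    using assms by (intro G_rate_mono) auto
  moreover have "nat \<lceil>ln (real (6 * N * (k + 1)))\<rceil> \<le> nat \<lceil>ln (real (6 * N * (k' + 1)))\<rceil>"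
    using assms by (intro nat_ceiling_ln_mono) auto
  ultimately show ?thesis
    unfolding nu1_def Let_def by (intro add_right_mono monoD[OF \<open>mono D\<close>] add_mono diff_le_mono) auto
qed

lemma nu2_mono:
  assumes "mono b" "mono D" "mono B" "mono L" "0 < N" "k \<le> k'"
  shows "nu2 N l b D B L k \<le> nu2 N l b D B L k'"
  unfolding nu2_def
  using assms by (intro max.mono monoD[OF \<open>mono b\<close>] nu1_mono diff_le_mono mult_le_mono) auto

lemma sigma_mono:
  assumes "mono D" "m \<le> n"
  shows "sigma N D k m \<le> sigma N D k n"
  unfolding sigma_def using assms by (intro add_right_mono monoD[OF \<open>mono D\<close>]) auto

text \<open>Krasnoselskii-Mann iteration with Tikhonov factors \<open>\<beta> n\<close> for an
  abstract nonexpansive map. The Douglas-Rachford scheme is the instance with relaxation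
  \<open>lam n / 2\<close> and lower bound \<open>1 / (2 * l)\<close>, whence \<open>2 * l\<close>
  in \<open>mu3\<close>.\<close>

locale tikhonov_iteration =
  fixes T :: "'a::real_inner \<Rightarrow> 'a" and x :: "nat \<Rightarrow> 'a" and \<beta> lam :: "nat \<Rightarrow> real"
    and p :: 'a and N l :: nat and b D B L :: "nat \<Rightarrow> nat"
  assumes nonexp: "\<And>u v. norm (T u - T v) \<le> norm (u - v)"
    and fixp: "T p = p"
    and N_pos: "0 < N" and l_pos: "0 < l"
    and norm_p: "norm p \<le> real N" and norm_x0: "norm (x 0 - p) \<le> real N"
    and \<beta>_pos: "\<And>n. 0 < \<beta> n" and \<beta>_le: "\<And>n. \<beta> n \<le> 1"
    and lam_le: "\<And>n. lam n \<le> 1" and lam_ge: "\<And>n. 1 / real l \<le> lam n"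
    and x_Suc: "\<And>n. x (Suc n) = \<beta> n *\<^sub>R x n + lam n *\<^sub>R (T (\<beta> n *\<^sub>R x n) - \<beta> n *\<^sub>R x n)"
    and mono_b: "mono b" and mono_D: "mono D" and mono_B: "mono B" and mono_L: "mono L"
    and b_rate: "\<And>k n. b k \<le> n \<Longrightarrow> \<bar>1 - \<beta> n\<bar> \<le> 1 / (real k + 1)"
    and D_rate: "\<And>k. real k \<le> (\<Sum>i=1..D k. 1 - \<beta> i)"
    and B_rate: "\<And>k n. (\<Sum>i=B k + 1..B k + n. \<bar>\<beta> i - \<beta> (i - 1)\<bar>) \<le> 1 / (real k + 1)"
    and L_rate: "\<And>k n. (\<Sum>i=L k + 1..L k + n. \<bar>lam i - lam (i - 1)\<bar>) \<le> 1 / (real k + 1)"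
begin

section \<open>Boundedness of the iterates\<close>

definition w :: "nat \<Rightarrow> 'a" where
  "w n = \<beta> n *\<^sub>R x n"

lemma lam_pos: "0 < lam n"
proof -
  have "0 < 1 / real l" using l_pos by simp
  then show ?thesis using lam_ge[of n] by linarith
qed

lemma x_Suc_w: "x (Suc n) = (1 - lam n) *\<^sub>R w n + lam n *\<^sub>R T (w n)"
  by (simp add: x_Suc w_def algebra_simps)

lemma norm_relaxed_diff:
  assumes "0 \<le> t" "t \<le> 1"
  shows "norm (((1 - t) *\<^sub>R u + t *\<^sub>R T u) - ((1 - t) *\<^sub>R v + t *\<^sub>R T v)) \<le> norm (u - v)"
proof -
  have "((1 - t) *\<^sub>R u + t *\<^sub>R T u) - ((1 - t) *\<^sub>R v + t *\<^sub>R T v) = (1 - t) *\<^sub>R (u - v) + t *\<^sub>R (T u - T v)"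
    by (simp add: algebra_simps)
  also have "norm \<dots> \<le> (1 - t) * norm (u - v) + t * norm (T u - T v)"
    using norm_triangle_ineq[of "(1 - t) *\<^sub>R (u - v)" "t *\<^sub>R (T u - T v)"] assms by simp
  also have "\<dots> \<le> (1 - t) * norm (u - v) + t * norm (u - v)"
    using assms by (intro add_left_mono mult_left_mono nonexp) auto
  finally show ?thesis by (simp add: algebra_simps)
qed

lemma norm_w_minus_p_le:
  assumes "norm (x n - p) \<le> real N"
  shows "norm (w n - p) \<le> real N"
proof -
  have "w n - p = \<beta> n *\<^sub>R (x n - p) + (1 - \<beta> n) *\<^sub>R (- p)"
    by (simp add: w_def algebra_simps)
  also have "norm \<dots> \<le> \<beta> n * norm (x n - p) + (1 - \<beta> n) * norm p"
    using norm_triangle_ineq[of "\<beta> n *\<^sub>R (x n - p)" "(1 - \<beta> n) *\<^sub>R (- p)"] \<beta>_pos[of n] \<beta>_le[of n] by simp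
  also have "\<dots> \<le> \<beta> n * real N + (1 - \<beta> n) * real N"
    using assms norm_p \<beta>_pos[of n] \<beta>_le[of n] by (intro add_mono mult_left_mono) auto
  finally show ?thesis by (simp add: algebra_simps)
qed

lemma norm_x_minus_p: "norm (x n - p) \<le> real N"
proof (induction n)
  case 0
  show ?case by (rule norm_x0)
next
  case (Suc n)
  have "norm (x (Suc n) - p) \<le> norm (w n - p)"
    using norm_relaxed_diff[of "lam n" "w n" p] lam_pos[of n] lam_le[of n]
    by (simp add: x_Suc_w fixp algebra_simps)
  also have "\<dots> \<le> real N"
    by (rule norm_w_minus_p_le[OF Suc])
  finally show ?case .
qed

lemma norm_w_minus_p: "norm (w n - p) \<le> real N"
  by (intro norm_w_minus_p_le norm_x_minus_p)

lemma norm_x: "norm (x n) \<le> 2 * real N"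
  using norm_triangle_ineq[of "x n - p" p] norm_x_minus_p[of n] norm_p by simp

lemma norm_T_w_minus_w: "norm (T (w n) - w n) \<le> 2 * real N"
  using norm_triangle_ineq4[of "T (w n) - T p" "w n - p"] nonexp[of "w n" p] norm_w_minus_p[of n] fixp
  by simp

lemma norm_x_minus_w:
  assumes "b (m - 1) \<le> n" "0 < m"
  shows "norm (x n - w n) \<le> 2 * real N / real m"
proof -
  have "x n - w n = (1 - \<beta> n) *\<^sub>R x n"
    by (simp add: w_def algebra_simps)
  then have "norm (x n - w n) = \<bar>1 - \<beta> n\<bar> * norm (x n)"
    by simp
  also have "\<dots> \<le> 1 / (real (m - 1) + 1) * (2 * real N)"
    using b_rate[OF assms(1)] norm_x[of n] by (intro mult_mono) auto
  finally show ?thesis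
    unfolding real_pred_plus_1[OF \<open>0 < m\<close>] by simp
qed

section \<open>Asymptotic regularity with explicit rates\<close>

lemma norm_T_w_minus_w_le:
  "norm (T (w n) - w n) \<le> real l * (norm (x (Suc n) - x n) + norm (x n - w n))"
proof -
  have "lam n *\<^sub>R (T (w n) - w n) = x (Suc n) - w n"
    by (simp add: x_Suc_w algebra_simps)
  then have "lam n * norm (T (w n) - w n) = norm (x (Suc n) - w n)"
    using lam_pos[of n] by (metis abs_of_pos norm_scaleR)
  also have "\<dots> \<le> norm (x (Suc n) - x n) + norm (x n - w n)"
    using norm_triangle_ineq[of "x (Suc n) - x n" "x n - w n"] by simp
  finally have "1 / real l * norm (T (w n) - w n) \<le> norm (x (Suc n) - x n) + norm (x n - w n)"
    using mult_right_mono[OF lam_ge[of n] norm_ge_zero[of "T (w n) - w n"]] by linarith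
  then show ?thesis
    using l_pos by (simp add: field_simps)
qed

text \<open>Three changes are separated: that of the argument passes through the nonexpansive
  relaxed map, that of \<open>lam\<close> multiplies a residual, and that of \<open>\<beta>\<close>
  multiplies \<open>x n\<close>. The last two vectors have norm at most
  \<open>2 * N\<close>.\<close>

lemma norm_step_le:
  "norm (x (Suc (Suc n)) - x (Suc n)) \<le> \<beta> (Suc n) * norm (x (Suc n) - x n)
    + 2 * real N * (\<bar>\<beta> (Suc n) - \<beta> n\<bar> + \<bar>lam (Suc n) - lam n\<bar>)"
proof -
  let ?S = "\<lambda>t u. (1 - t) *\<^sub>R u + t *\<^sub>R T u"
  have "x (Suc (Suc n)) - x (Suc n) = (?S (lam (Suc n)) (w (Suc n)) - ?S (lam (Suc n)) (w n))
      + (lam (Suc n) - lam n) *\<^sub>R (T (w n) - w n)"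
    unfolding x_Suc_w[of "Suc n"] x_Suc_w[of n] by (simp add: algebra_simps)
  then have "norm (x (Suc (Suc n)) - x (Suc n))
      \<le> norm (?S (lam (Suc n)) (w (Suc n)) - ?S (lam (Suc n)) (w n))
        + \<bar>lam (Suc n) - lam n\<bar> * norm (T (w n) - w n)"
    by (metis norm_scaleR norm_triangle_ineq)
  also have "\<dots> \<le> norm (w (Suc n) - w n) + \<bar>lam (Suc n) - lam n\<bar> * (2 * real N)"
    using lam_pos[of "Suc n"] lam_le[of "Suc n"]
    by (intro add_mono norm_relaxed_diff mult_left_mono norm_T_w_minus_w) auto
  also have "norm (w (Suc n) - w n) \<le> \<beta> (Suc n) * norm (x (Suc n) - x n) + \<bar>\<beta> (Suc n) - \<beta> n\<bar> * (2 * real N)"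
  proof -
    have "w (Suc n) - w n = \<beta> (Suc n) *\<^sub>R (x (Suc n) - x n) + (\<beta> (Suc n) - \<beta> n) *\<^sub>R x n"
      by (simp add: w_def algebra_simps)
    also have "norm \<dots> \<le> \<beta> (Suc n) * norm (x (Suc n) - x n) + \<bar>\<beta> (Suc n) - \<beta> n\<bar> * norm (x n)"
      using norm_triangle_ineq[of "\<beta> (Suc n) *\<^sub>R (x (Suc n) - x n)" "(\<beta> (Suc n) - \<beta> n) *\<^sub>R x n"] \<beta>_pos[of "Suc n"]
      by simp
    also have "\<dots> \<le> \<beta> (Suc n) * norm (x (Suc n) - x n) + \<bar>\<beta> (Suc n) - \<beta> n\<bar> * (2 * real N)"
      by (intro add_left_mono mult_left_mono norm_x) auto
    finally show ?thesis .
  qed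
  finally show ?thesis by (simp add: algebra_simps)
qed

text \<open>Each \<open>1 - \<beta> i\<close> is at most 1, so at least \<open>k\<close> summands
  are needed. Hence indices past \<open>D (m + r)\<close> lie past \<open>m\<close>, where
  recursions are started.\<close>

lemma D_ge: "k \<le> D k"
proof -
  have "real k \<le> (\<Sum>i=1..D k. 1)"
    using D_rate[of k] sum_mono[of "{1..D k}" "\<lambda>i. 1 - \<beta> i" "\<lambda>_. 1"] \<beta>_pos by (smt (verit))
  then show ?thesis by simp
qed

lemma prod_\<beta>_le:
  assumes "m \<le> Suc m'" "0 < c" "D (m' + nat \<lceil>ln c\<rceil>) \<le> n"
  shows "(\<Prod>i=m..n. \<beta> i) \<le> 1 / c"
  by (rule prod_le_inverse_of_divergence[OF _ \<beta>_le D_rate assms]) (simp add: \<beta>_pos less_imp_le)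

lemma nu1_rate:
  assumes n: "nu1 N D B L k \<le> n"
  shows "norm (x (Suc n) - x n) \<le> 1 / (real k + 1)"
proof -
  define G where "G = G_rate N B L (3 * k + 2)"
  define r where "r = nat \<lceil>ln (real (6 * N * (k + 1)))\<rceil>"
  define s where "s j = norm (x j - x (j - 1))" for j
  define c where "c j = 2 * real N * (\<bar>\<beta> j - \<beta> (j - 1)\<bar> + \<bar>lam j - lam (j - 1)\<bar>)" for j
  \<comment> \<open>The \<open>M - 1\<close> in \<open>nu1\<close> is \<open>G\<close>, while the
    product below starts at \<open>Suc G\<close>; this is the offset in
    \<open>prod_\<beta>_le\<close>.\<close>
  have Dn: "D (G + r) + 1 \<le> n"
    using n by (simp add: nu1_def G_def r_def)
  then have Gn: "Suc G \<le> n"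
    using D_ge[of "G + r"] by linarith
  have "s (Suc n) \<le> (\<Prod>i=Suc G..n. \<beta> i) * s (Suc G) + (\<Sum>i=Suc G..n. c i)"
  proof (rule contractive_recursion_bound[OF _ _ \<beta>_le _ Gn])
    fix j assume "Suc G \<le> j"
    then obtain i where "j = Suc i" by (cases j) auto
    then show "s (Suc j) \<le> \<beta> j * s j + c j"
      using norm_step_le[of i] by (simp add: s_def c_def)
  qed (simp_all add: c_def \<beta>_pos less_imp_le)
  \<comment> \<open>The product times a step of norm at most \<open>2 * N\<close> gives one third of
    \<open>1 / (k + 1)\<close>; the variation of \<open>\<beta>\<close> and \<open>lam\<close> after
    \<open>G\<close> gives another third.\<close>
  also have "\<dots> \<le> 1 / (6 * real N * (real k + 1)) * (2 * real N) + 1 / (3 * (real k + 1))"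
  proof (intro add_mono mult_mono)
    show "(\<Prod>i=Suc G..n. \<beta> i) \<le> 1 / (6 * real N * (real k + 1))"
    proof -
      have "0 < real (6 * N * (k + 1))" using N_pos by (simp only: of_nat_0_less_iff) simp
      from prod_\<beta>_le[OF order_refl this, of G n] Dn have "(\<Prod>i=Suc G..n. \<beta> i) \<le> 1 / real (6 * N * (k + 1))"
        by (simp only: r_def)
      also have "real (6 * N * (k + 1)) = 6 * real N * (real k + 1)"
        by (simp add: algebra_simps)
      finally show ?thesis .
    qed
    show "s (Suc G) \<le> 2 * real N"
      using norm_triangle_ineq4[of "x (Suc G) - p" "x G - p"] norm_x_minus_p[of "Suc G"] norm_x_minus_p[of G]
      by (simp add: s_def)
    have "(\<Sum>i=Suc G..n. \<bar>\<beta> i - \<beta> (i - 1)\<bar>) \<le> 1 / real (4 * N * (3 * k + 2 + 1))"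
      using N_pos by (intro tail_sum_le[OF B_rate]) (auto simp: G_def G_rate_def)
    moreover have "(\<Sum>i=Suc G..n. \<bar>lam i - lam (i - 1)\<bar>) \<le> 1 / real (10 * N * (3 * k + 2 + 1))"
      using N_pos by (intro tail_sum_le[OF L_rate]) (auto simp: G_def G_rate_def)
    moreover have "1 / real (10 * N * (3 * k + 2 + 1)) \<le> 1 / real (4 * N * (3 * k + 2 + 1))"
    proof (rule frac_le)
      have "0 < 4 * N * (3 * k + 2 + 1)" using N_pos by simp
      then show "0 < real (4 * N * (3 * k + 2 + 1))" by (rule of_nat_0_less_iff[THEN iffD2])
      have "4 * N * (3 * k + 2 + 1) \<le> 10 * N * (3 * k + 2 + 1)" by (intro mult_le_mono) auto
      then show "real (4 * N * (3 * k + 2 + 1)) \<le> real (10 * N * (3 * k + 2 + 1))" by (rule of_nat_mono)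
    qed simp_all
    ultimately have "(\<Sum>i=Suc G..n. \<bar>\<beta> i - \<beta> (i - 1)\<bar> + \<bar>lam i - lam (i - 1)\<bar>) \<le> 2 / real (4 * N * (3 * k + 2 + 1))"
      by (simp add: sum.distrib)
    then have "(\<Sum>i=Suc G..n. c i) \<le> 2 * real N * (2 / real (4 * N * (3 * k + 2 + 1)))"
      unfolding c_def sum_distrib_left[symmetric] by (intro mult_left_mono) auto
    also have "real (4 * N * (3 * k + 2 + 1)) = 4 * real N * (3 * (real k + 1))"
      by (simp add: algebra_simps)
    also have "2 * real N * (2 / (4 * real N * q)) = 1 / q" for q
      using N_pos by simp
    finally show "(\<Sum>i=Suc G..n. c i) \<le> 1 / (3 * (real k + 1))" .
  qed (simp_all add: s_def)
  also have "\<dots> \<le> 1 / (real k + 1)"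
    using N_pos by (simp add: field_simps)
  finally show ?thesis by (simp add: s_def)
qed

text \<open>The residual is at most \<open>l\<close> times the sum of a step and of
  \<open>|x n - w n|\<close>; the two rates joined in \<open>nu2\<close> bound each of these by
  \<open>1 / (2 * l * (k + 1))\<close>.\<close>

lemma nu2_rate:
  assumes n: "nu2 N l b D B L k \<le> n"
  shows "norm (T (w n) - w n) \<le> 1 / (real k + 1)"
proof -
  have "norm (x (Suc n) - x n) \<le> 1 / (real (2 * l * (k + 1) - 1) + 1)"
    using n by (intro nu1_rate) (simp add: nu2_def)
  then have 1: "norm (x (Suc n) - x n) \<le> 1 / real (2 * l * (k + 1))"
    using l_pos by (subst (asm) real_pred_plus_1) auto
  have 2: "norm (x n - w n) \<le> 2 * real N / real (4 * N * l * (k + 1))"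
    using n N_pos l_pos by (intro norm_x_minus_w) (auto simp: nu2_def)
  have "norm (T (w n) - w n) \<le> real l * (1 / real (2 * l * (k + 1)) + 2 * real N / real (4 * N * l * (k + 1)))"
    using 1 2 by (intro order_trans[OF norm_T_w_minus_w_le] mult_left_mono add_mono) auto
  also have "\<dots> = 1 / (real k + 1)"
  proof -
    define c where "c = real k + 1"
    have "0 < c" by (simp add: c_def)
    then have "real l * (1 / (2 * real l * c) + 2 * real N / (4 * real N * real l * c)) = 1 / c"
      using N_pos l_pos by (simp add: field_simps)
    moreover have "real (2 * l * (k + 1)) = 2 * real l * c" "real (4 * N * l * (k + 1)) = 4 * real N * real l * c"
      by (simp_all add: c_def algebra_simps)
    ultimately show ?thesis by (simp only: c_def)
  qed
  finally show ?thesis .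
qed

section \<open>Metastability of the regularised iteration\<close>

lemma norm_x_Suc_minus_square_le:
  assumes u: "norm (u - p) \<le> real N" and Tu: "norm (T u - u) \<le> e"
  shows "(norm (x (Suc n) - u))\<^sup>2
    \<le> \<beta> n * (norm (x n - u))\<^sup>2 + (1 - \<beta> n) * (2 * (u \<bullet> (u - w n))) + (4 * real N * e + e\<^sup>2)"
proof -
  have e: "0 \<le> e" using Tu norm_ge_zero order_trans by blast
  have wu: "norm (w n - u) \<le> 2 * real N"
    using norm_triangle_ineq4[of "w n - p" "u - p"] norm_w_minus_p[of n] u by simp
  \<comment> \<open>The relaxed map is nonexpansive but displaces \<open>u\<close> by
    \<open>lam n *\<^sub>R (T u - u)\<close>, of norm at most \<open>e\<close>; squaring then
    produces the error \<open>4 * N * e + e^2\<close>.\<close>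
  have "x (Suc n) - u = (((1 - lam n) *\<^sub>R w n + lam n *\<^sub>R T (w n)) - ((1 - lam n) *\<^sub>R u + lam n *\<^sub>R T u))
      + lam n *\<^sub>R (T u - u)"
    by (simp add: x_Suc_w algebra_simps)
  then have "norm (x (Suc n) - u) \<le> norm (((1 - lam n) *\<^sub>R w n + lam n *\<^sub>R T (w n)) - ((1 - lam n) *\<^sub>R u + lam n *\<^sub>R T u))
      + norm (lam n *\<^sub>R (T u - u))"
    by (metis norm_triangle_ineq)
  also have "\<dots> \<le> norm (w n - u) + 1 * e"
    using lam_pos[of n] lam_le[of n] Tu e unfolding norm_scaleR
    by (intro add_mono norm_relaxed_diff mult_mono) auto
  finally have "(norm (x (Suc n) - u))\<^sup>2 \<le> (norm (w n - u) + e)\<^sup>2"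
    by (intro power_mono) auto
  also have "\<dots> = (norm (w n - u))\<^sup>2 + (2 * e * norm (w n - u) + e\<^sup>2)"
    by (simp add: power2_eq_square algebra_simps)
  also have "\<dots> \<le> (norm (w n - u))\<^sup>2 + (2 * e * (2 * real N) + e\<^sup>2)"
    using e wu by (intro add_left_mono add_right_mono mult_left_mono) auto
  also have "(norm (w n - u))\<^sup>2 \<le> \<beta> n * (norm (x n - u))\<^sup>2 + (1 - \<beta> n) * (2 * (u \<bullet> (u - w n)))"
  proof -
    \<comment> \<open>Expanding the square of \<open>(w n - u) + (1 - \<beta> n) *\<^sub>R u\<close>
      isolates \<open>u \<bullet> (u - w n)\<close>, which the approximate projection controls; the
      square of the second summand is nonnegative and is dropped.\<close>
    have split: "w n - u = \<beta> n *\<^sub>R (x n - u) + (1 - \<beta> n) *\<^sub>R (- u)"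
      by (simp add: w_def algebra_simps)
    have "(norm (\<beta> n *\<^sub>R (x n - u)))\<^sup>2
        = (norm (w n - u))\<^sup>2 - (1 - \<beta> n) * (2 * (u \<bullet> (u - w n))) + (norm ((1 - \<beta> n) *\<^sub>R u))\<^sup>2"
    proof -
      have "\<beta> n *\<^sub>R (x n - u) = (w n - u) + (1 - \<beta> n) *\<^sub>R u"
        unfolding split by simp
      then show ?thesis
        unfolding power2_norm_eq_inner
        by (simp only: inner_add_left inner_add_right) (simp add: inner_diff_left inner_diff_right inner_commute algebra_simps)
    qed
    moreover have "(norm (\<beta> n *\<^sub>R (x n - u)))\<^sup>2 \<le> \<beta> n * (norm (x n - u))\<^sup>2"
    proof -
      have "(norm (\<beta> n *\<^sub>R (x n - u)))\<^sup>2 = (\<beta> n)\<^sup>2 * (norm (x n - u))\<^sup>2"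
        by (simp add: power_mult_distrib)
      also have "\<dots> \<le> \<beta> n * (norm (x n - u))\<^sup>2"
        using \<beta>_pos[of n] \<beta>_le[of n] by (intro mult_right_mono) (auto simp: power2_eq_square mult_left_le)
      finally show ?thesis .
    qed
    ultimately show ?thesis
      using zero_le_power2[of "norm ((1 - \<beta> n) *\<^sub>R u)"] by linarith
  qed
  finally show ?thesis by (simp add: algebra_simps)
qed

text \<open>Every \<open>w i\<close> with \<open>i\<close> beyond \<open>nu2\<close> at
  \<open>n\<close> is an approximate fixed point of tolerance \<open>1 / (n + 1)\<close>, so the
  variational inequality covers a whole tail. The index claimed is this value of \<open>nu2\<close>,
  which explains the composition of \<open>f\<close> with \<open>nu2\<close> in
  \<open>psi\<close>.\<close>

lemma psi_approximate_projection:
  fixes f :: "nat \<Rightarrow> nat"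
  shows "\<exists>n \<le> psi N l b D B L k f. \<exists>u. norm (u - p) \<le> real N \<and> norm (T u - u) \<le> 1 / (real (f n) + 1) \<and>
    (\<forall>i\<ge>n. u \<bullet> (u - w i) \<le> 1 / (2 * (real k + 1)))"
proof -
  let ?\<nu> = "nu2 N l b D B L"
  obtain n u where n: "n \<le> 48 * N * (((\<lambda>m. max (f (?\<nu> (48 * N * (m + 1) ^ 2))) (48 * N * (m + 1) ^ 2))
        ^^ (64 * N ^ 4 * (k + 1) ^ 2)) 0 + 1) ^ 2"
    and u: "norm (u - p) \<le> real N" "norm (T u - u) \<le> 1 / (real (f (?\<nu> n)) + 1)"
    and proj: "\<And>w. norm (w - p) \<le> real N \<Longrightarrow> norm (T w - w) \<le> 1 / (real n + 1) \<Longrightarrow>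
      u \<bullet> (u - w) \<le> 1 / (2 * (real k + 1))"
    using approximate_projection[OF nonexp fixp norm_p N_pos, where g = "\<lambda>m. f (?\<nu> m)" and k = k] by blast
  have "?\<nu> n \<le> psi N l b D B L k f"
    unfolding psi_def Let_def using nu2_mono[OF mono_b mono_D mono_B mono_L N_pos n] by simp
  moreover have "u \<bullet> (u - w i) \<le> 1 / (2 * (real k + 1))" if "?\<nu> n \<le> i" for i
    using proj norm_w_minus_p nu2_rate that by blast
  ultimately show ?thesis
    using u by blast
qed

theorem mu_metastability:
  fixes f h :: "nat \<Rightarrow> nat"
  assumes h: "\<And>n. h n \<noteq> 0"
  shows "\<exists>n\<le>mu N l b h D B L k f. \<forall>i\<in>{n..f n}. \<forall>j\<in>{n..f n}. norm (x i - x j) \<le> 1 / (real k + 1)"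
proof -
  \<comment> \<open>Squared distances are estimated: \<open>1 / (K + 1)\<close> is the square of
    \<open>1 / (2 * (k + 1))\<close>, half the final accuracy, as two iterates are compared through
    \<open>u\<close>.\<close>
  define K where "K = 4 * (k + 1) ^ 2 - 1"
  define n1 where "n1 = b (54 * N ^ 2 * (K + 1) - 1)"
  define f1 where "f1 = (\<lambda>m. f (sigma N D K (max m n1)))"
  define f2 where "f2 = (\<lambda>m. 3 * (10 * N + 1) * (K + 1) * (f1 m + 1) * h (f1 m) - 1)"
  have K: "real K + 1 = 4 * (real k + 1)\<^sup>2"
    unfolding K_def by (subst real_pred_plus_1) auto
  obtain n0 u where n0: "n0 \<le> psi N l b D B L (12 * (K + 1) - 1) f2"
    and u: "norm (u - p) \<le> real N" and Tu: "norm (T u - u) \<le> 1 / (real (f2 n0) + 1)"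
    and proj: "\<And>i. n0 \<le> i \<Longrightarrow> u \<bullet> (u - w i) \<le> 1 / (2 * (real (12 * (K + 1) - 1) + 1))"
    using psi_approximate_projection by blast
  define m where "m = max n0 n1"
  define S where "S = sigma N D K m"
  define e where "e = 1 / (real (f2 n0) + 1)"
  define \<eta> where "\<eta> = 1 / (12 * (real K + 1))"
  define err where "err = 4 * real N * e + e\<^sup>2"
  have "mu N l b h D B L k f = sigma N D K (max (psi N l b D B L (12 * (K + 1) - 1) f2) n1)"
    by (simp only: mu_def Let_def K_def n1_def f1_def f2_def)
  then have S_le: "S \<le> mu N l b h D B L k f"
    using n0 by (simp only: S_def m_def) (intro sigma_mono[OF mono_D] max.mono order_refl)
  \<comment> \<open>\<open>f1 n0\<close> is \<open>f S\<close>, so the tolerance of \<open>u\<close>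
    already accounts for the end of the interval; \<open>err\<close> is summed over at most
    \<open>f S + 1\<close> steps.\<close>
  have e: "e = 1 / (3 * (10 * real N + 1) * (real K + 1) * (real (f S) + 1) * real (h (f S)))"
    using h[of "f S"] unfolding e_def f2_def by (subst real_pred_plus_1) (auto simp: f1_def S_def m_def algebra_simps)
  have e0: "0 < e" and e1: "e \<le> 1"
    by (simp_all add: e_def)
  have err: "(real (f S) + 1) * err \<le> 1 / (3 * (real K + 1))"
  proof -
    have "e\<^sup>2 \<le> e" using e0 e1 by (simp add: power2_eq_square mult_left_le)
    moreover have "4 * real N * e \<le> 10 * real N * e" using e0 by simp
    ultimately have "err \<le> (10 * real N + 1) * e"
      by (simp add: err_def algebra_simps)
    then have "(real (f S) + 1) * err \<le> (real (f S) + 1) * ((10 * real N + 1) * e)"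
      by (intro mult_left_mono) auto
    also have "\<dots> = 1 / (3 * (real K + 1)) / real (h (f S))"
    proof -
      have "F * (a * (1 / (3 * a * q * F * H))) = 1 / (3 * q) / H" if "a \<noteq> 0" "F \<noteq> 0" for a F q H :: real
        using that by simp
      moreover have "10 * real N + 1 \<noteq> 0" "real (f S) + 1 \<noteq> 0"
        by linarith+
      ultimately show ?thesis unfolding e by blast
    qed
    also have "\<dots> \<le> 1 / (3 * (real K + 1)) / 1"
      using h[of "f S"] by (intro divide_left_mono) auto
    finally show ?thesis by simp
  qed
  have u2: "2 * (u \<bullet> (u - w i)) \<le> \<eta>" if "n0 \<le> i" for i
  proof -
    have "real (12 * (K + 1) - 1) + 1 = 12 * (real K + 1)"
      by simp
    with proj[OF that] have "u \<bullet> (u - w i) \<le> 1 / (2 * (12 * (real K + 1)))"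
      by (simp only:)
    moreover have "1 / (2 * A) = 1 / A / 2" for A :: real
      by simp
    ultimately have "u \<bullet> (u - w i) \<le> \<eta> / 2"
      unfolding \<eta>_def by (simp only:)
    then show ?thesis
      by simp
  qed
  have close: "norm (x i - u) \<le> 1 / (2 * (real k + 1))" if i: "i \<in> {S..f S}" for i
  proof -
    \<comment> \<open>Subtracting \<open>\<eta>\<close>, a fixed point of
      \<open>a \<mapsto> \<beta> j * a + (1 - \<beta> j) * \<eta>\<close>, absorbs the drift and
      leaves a contraction with error \<open>err\<close>.\<close>
    define s where "s j = (norm (x j - u))\<^sup>2 - \<eta>" for j
    \<comment> \<open>The summand 1 in \<open>sigma\<close> makes \<open>i\<close> a successor and
      keeps \<open>j\<close> at or above the value of \<open>D\<close>; the bound on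
      \<open>x (Suc j)\<close> involves factors up to \<open>j\<close>.\<close>
    obtain j where j: "i = Suc j"
      using i by (cases i) (auto simp: S_def sigma_def)
    have Dj: "D (m + nat \<lceil>ln (real (27 * N ^ 2 * (K + 1)))\<rceil>) \<le> j"
      using i by (simp add: j S_def sigma_def)
    then have mj: "m \<le> j"
      using D_ge[of "m + nat \<lceil>ln (real (27 * N ^ 2 * (K + 1)))\<rceil>"] by linarith
    have "s (Suc j) \<le> (\<Prod>i=m..j. \<beta> i) * s m + (\<Sum>i=m..j. err)"
    proof (rule contractive_recursion_bound[OF _ _ \<beta>_le _ mj])
      fix j assume "m \<le> j"
      then have "(1 - \<beta> j) * (2 * (u \<bullet> (u - w j))) \<le> (1 - \<beta> j) * \<eta>"
        using u2[of j] \<beta>_le[of j] by (intro mult_left_mono) (auto simp: m_def)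
      moreover have "(norm (x (Suc j) - u))\<^sup>2
          \<le> \<beta> j * (norm (x j - u))\<^sup>2 + (1 - \<beta> j) * (2 * (u \<bullet> (u - w j))) + err"
        using norm_x_Suc_minus_square_le[OF u Tu, of j] by (simp only: err_def e_def)
      ultimately have "(norm (x (Suc j) - u))\<^sup>2 \<le> \<beta> j * (norm (x j - u))\<^sup>2 + (1 - \<beta> j) * \<eta> + err"
        by linarith
      then show "s (Suc j) \<le> \<beta> j * s j + err"
        by (simp add: s_def algebra_simps)
    qed (use \<beta>_pos e0 in \<open>auto simp: err_def less_imp_le\<close>)
    also have "\<dots> \<le> 1 / (27 * (real N)\<^sup>2 * (real K + 1)) * (2 * real N)\<^sup>2 + 1 / (3 * (real K + 1))"
    proof (rule add_mono)
      have "(\<Prod>i=m..j. \<beta> i) * s m \<le> (\<Prod>i=m..j. \<beta> i) * (2 * real N)\<^sup>2"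
      proof (rule mult_left_mono)
        have "norm (x m - u) \<le> 2 * real N"
          using norm_triangle_ineq4[of "x m - p" "u - p"] norm_x_minus_p[of m] u by simp
        then have "(norm (x m - u))\<^sup>2 \<le> (2 * real N)\<^sup>2"
          by (intro power_mono) auto
        moreover have "0 \<le> \<eta>" by (simp add: \<eta>_def)
        ultimately show "s m \<le> (2 * real N)\<^sup>2"
          by (simp add: s_def)
      qed (simp add: prod_nonneg \<beta>_pos less_imp_le)
      also have "\<dots> \<le> 1 / (27 * (real N)\<^sup>2 * (real K + 1)) * (2 * real N)\<^sup>2"
      proof (rule mult_right_mono)
        have "0 < real (27 * N ^ 2 * (K + 1))" using N_pos by (simp only: of_nat_0_less_iff) simp
        from prod_\<beta>_le[OF _ this Dj, of m] have "(\<Prod>i=m..j. \<beta> i) \<le> 1 / real (27 * N ^ 2 * (K + 1))"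
          by simp
        also have "real (27 * N ^ 2 * (K + 1)) = 27 * (real N)\<^sup>2 * (real K + 1)"
          by (simp add: algebra_simps)
        finally show "(\<Prod>i=m..j. \<beta> i) \<le> 1 / (27 * (real N)\<^sup>2 * (real K + 1))" .
      qed simp
      finally show "(\<Prod>i=m..j. \<beta> i) * s m \<le> 1 / (27 * (real N)\<^sup>2 * (real K + 1)) * (2 * real N)\<^sup>2" .
      have "Suc j - m \<le> f S + 1"
        using i j by auto
      then have "real (Suc j - m) \<le> real (f S) + 1"
        using of_nat_mono[of "Suc j - m" "f S + 1"] by (simp only: of_nat_add of_nat_1)
      then have "(\<Sum>i=m..j. err) \<le> (real (f S) + 1) * err"
        using e0 by (simp only: sum_constant card_atLeastAtMost) (intro mult_right_mono, auto simp: err_def)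
      with err show "(\<Sum>i=m..j. err) \<le> 1 / (3 * (real K + 1))"
        by linarith
    qed
    finally have "(norm (x i - u))\<^sup>2
        \<le> 1 / (27 * (real N)\<^sup>2 * (real K + 1)) * (2 * real N)\<^sup>2 + 1 / (3 * (real K + 1)) + \<eta>"
      by (simp add: s_def j)
    \<comment> \<open>The budget is 4/27 from the initial distance, 1/3 from the errors and 1/12
      from \<open>\<eta>\<close>, together 61/108.\<close>
    also have "\<dots> \<le> 1 / (real K + 1)"
    proof -
      have "1 / (27 * (real N)\<^sup>2 * q) * (2 * real N)\<^sup>2 + 1 / (3 * q) + 1 / (12 * q) = (4 / 27 + 1 / 3 + 1 / 12) * (1 / q)" for q :: real
        using N_pos by (simp add: power_mult_distrib distrib_right)
      moreover have "(4 / 27 + 1 / 3 + 1 / 12) * (1 / (real K + 1)) \<le> 1 * (1 / (real K + 1))"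
        by (rule mult_right_mono) simp_all
      ultimately show ?thesis
        unfolding \<eta>_def by (simp only: mult_1)
    qed
    also have "\<dots> = (1 / (2 * (real k + 1)))\<^sup>2"
      unfolding K by (simp add: power2_eq_square algebra_simps)
    finally show ?thesis
      by (rule power2_le_imp_le) simp
  qed
  have "norm (x i - x j) \<le> 1 / (real k + 1)" if "i \<in> {S..f S}" "j \<in> {S..f S}" for i j
  proof -
    have "norm (x i - x j) \<le> norm (x i - u) + norm (x j - u)"
      using norm_triangle_ineq4[of "x i - u" "x j - u"] by simp
    also have "\<dots> \<le> 1 / (2 * (real k + 1)) + 1 / (2 * (real k + 1))"
      using that by (intro add_mono close)
    also have "1 / (2 * c) + 1 / (2 * c) = 1 / c" for c :: real
      by (cases "c = 0") (simp_all add: field_simps)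
    finally show ?thesis .
  qed
  with S_le show ?thesis by blast
qed

end

section \<open>Transfer to the Douglas-Rachford iteration\<close>

theorem corollary3p10:
  fixes T\<^sub>1 T\<^sub>2 :: "'a::{real_inner, complete_space} \<Rightarrow> 'a set"
    and \<gamma> :: real
    and \<beta> lam :: "nat \<Rightarrow> real"
    and x y z :: "nat \<Rightarrow> 'a"
    and N l :: nat
    and b D B L h :: "nat \<Rightarrow> nat"
  assumes "maximal_monotone T\<^sub>1" and "maximal_monotone T\<^sub>2" and "\<gamma> > 0"
    and "\<forall>n. \<beta> n \<in> {0<..1}"
    and "\<forall>n. lam n \<in> {0<..2}"
    and "\<forall>n. y n = resolvent \<gamma> T\<^sub>2 (\<beta> n *\<^sub>R x n)"
    and "\<forall>n. z n = resolvent \<gamma> T\<^sub>1 (2 *\<^sub>R y n - \<beta> n *\<^sub>R x n)"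
    and "\<forall>n. x (Suc n) = \<beta> n *\<^sub>R x n + lam n *\<^sub>R (z n - y n)"
    and "l \<noteq> 0"
    and "mono b" and "mono D" and "mono B" and "mono L" and "mono h"
    and "\<forall>n. h n \<noteq> 0"
    and "\<forall>n. \<beta> n \<ge> 1 / real (h n)"
    and "\<forall>k. \<forall>n\<ge>b k. \<bar>1 - \<beta> n\<bar> \<le> 1 / (real k + 1)"
    and "\<forall>k. (\<Sum>i=1..D k. 1 - \<beta> i) \<ge> real k"
    and "\<forall>k n. (\<Sum>i=B k + 1..B k + n. \<bar>\<beta> i - \<beta> (i - 1)\<bar>) \<le> 1 / (real k + 1)"
    and "\<forall>n. lam n \<ge> 1 / real l"
    and "\<forall>k n. (\<Sum>i=L k + 1..L k + n. \<bar>lam i - lam (i - 1)\<bar>) \<le> 1 / (real k + 1)"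
    and "N \<noteq> 0"
    and "\<exists>p\<in>Fix (reflected_resolvent \<gamma> T\<^sub>1 \<circ> reflected_resolvent \<gamma> T\<^sub>2).
           real N \<ge> max (norm (x 0 - p)) (norm p)"
  shows "\<forall>k. \<forall>f :: nat \<Rightarrow> nat. mono f \<longrightarrow>
      (\<exists>n\<le>mu3 N l b h D B L k f. \<forall>i\<in>{n..f n}. \<forall>j\<in>{n..f n}. norm (x i - x j) \<le> 1 / (real k + 1)) \<and>
      (\<exists>n\<le>mu4 N l b h D B L k f. \<forall>i\<in>{n..f n}. \<forall>j\<in>{n..f n}. norm (y i - y j) \<le> 1 / (real k + 1)) \<and>
      (\<exists>n\<le>mu5 N l b h D B L k f. \<forall>i\<in>{n..f n}. \<forall>j\<in>{n..f n}. norm (z i - z j) \<le> 1 / (real k + 1))"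
proof -
  define T where "T = reflected_resolvent \<gamma> T\<^sub>1 \<circ> reflected_resolvent \<gamma> T\<^sub>2"
  obtain p where p: "T p = p" "norm (x 0 - p) \<le> real N" "norm p \<le> real N"
    using assms(23) by (auto simp: T_def Fix_def)
  \<comment> \<open>The two reflections move \<open>\<beta> n *\<^sub>R x n\<close> by twice
    \<open>z n - y n\<close>, so halving the relaxation turns the scheme into the abstract
    iteration.\<close>
  have T_minus: "T (\<beta> n *\<^sub>R x n) - \<beta> n *\<^sub>R x n = 2 *\<^sub>R (z n - y n)" for n
  proof -
    have "reflected_resolvent \<gamma> T\<^sub>2 (\<beta> n *\<^sub>R x n) = 2 *\<^sub>R y n - \<beta> n *\<^sub>R x n"
      using assms(6) by (simp add: reflected_resolvent_def)
    moreover have "reflected_resolvent \<gamma> T\<^sub>1 (2 *\<^sub>R y n - \<beta> n *\<^sub>R x n) = 2 *\<^sub>R z n - (2 *\<^sub>R y n - \<beta> n *\<^sub>R x n)"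
      using assms(7) by (simp add: reflected_resolvent_def)
    ultimately have "T (\<beta> n *\<^sub>R x n) = 2 *\<^sub>R z n - (2 *\<^sub>R y n - \<beta> n *\<^sub>R x n)"
      by (simp add: T_def)
    then show ?thesis
      by (simp add: algebra_simps)
  qed
  interpret tikhonov_iteration T x \<beta> "\<lambda>n. lam n / 2" p N "2 * l" b D B L
  proof
    show "norm (T u - T v) \<le> norm (u - v)" for u v
      unfolding T_def o_def
      using reflected_resolvent_nonexpansive[OF assms(1,3)] reflected_resolvent_nonexpansive[OF assms(2,3)] order_trans
      by blast
    show "x (Suc n) = \<beta> n *\<^sub>R x n + (lam n / 2) *\<^sub>R (T (\<beta> n *\<^sub>R x n) - \<beta> n *\<^sub>R x n)" for n
      using assms(8) T_minus[of n] by simp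
    show "1 / real (2 * l) \<le> lam n / 2" for n
    proof -
      have "1 / real l / 2 \<le> lam n / 2"
        using assms(20) by (intro divide_right_mono) auto
      then show ?thesis by (simp add: mult.commute)
    qed
    \<comment> \<open>Halving \<open>lam\<close> can only shrink its variation, so \<open>L\<close>
      remains a rate.\<close>
    show "(\<Sum>i=L k + 1..L k + n. \<bar>lam i / 2 - lam (i - 1) / 2\<bar>) \<le> 1 / (real k + 1)" for k n
    proof -
      have "(\<Sum>i=L k + 1..L k + n. \<bar>lam i / 2 - lam (i - 1) / 2\<bar>) \<le> (\<Sum>i=L k + 1..L k + n. \<bar>lam i - lam (i - 1)\<bar>)"
        by (intro sum_mono) (simp flip: diff_divide_distrib)
      then show ?thesis
        using assms(21) order_trans by blast
    qed
  qed (use assms p in auto)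
  \<comment> \<open>The cases \<open>m = 2\<close> for \<open>y\<close> and \<open>m = 3 * l\<close>
    for \<open>z\<close> give the arguments \<open>8 * N * (k + 1) - 1\<close> and
    \<open>12 * l * N * (k + 1) - 1\<close> of \<open>b\<close>.\<close>
  have xw: "norm (x i - w i) \<le> 1 / (2 * (q * (real k + 1)))"
    if "b (4 * m * N * (k + 1) - 1) \<le> i" "0 < m" "q = real m" for i m k q
  proof -
    have "0 < 4 * m * N * (k + 1)"
      using that N_pos by simp
    with that have "norm (x i - w i) \<le> 2 * real N / real (4 * m * N * (k + 1))"
      by (intro norm_x_minus_w)
    also have "real (4 * m * N * (k + 1)) = 4 * real N * (q * (real k + 1))"
      by (simp add: that algebra_simps)
    also have "2 * real N / (4 * real N * c) = 1 / (2 * c)" for c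
      using N_pos by simp
    finally show ?thesis .
  qed
  have conv_x: "\<exists>n\<le>mu3 N l b h D B L k f. \<forall>i\<in>{n..f n}. \<forall>j\<in>{n..f n}. norm (x i - x j) \<le> 1 / (real k + 1)" for k f
    unfolding mu3_def using assms(15) by (intro mu_metastability) auto
  have conv_y: "\<exists>n\<le>mu4 N l b h D B L k f. \<forall>i\<in>{n..f n}. \<forall>j\<in>{n..f n}. norm (y i - y j) \<le> 1 / (real k + 1)" for k f
  proof -
    define c where "c = b (8 * N * (k + 1) - 1)"
    \<comment> \<open>Evaluating \<open>f\<close> at \<open>max m c\<close> places
      \<open>{max n c..f (max n c)}\<close> inside \<open>{n..g n}\<close>, so on the interval from
      the new witness \<open>max n c\<close> both the closeness of the \<open>x i\<close> and the
      rate of \<open>b\<close> are available.\<close>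
    define g where "g = (\<lambda>m. f (max m c))"
    obtain n where n: "n \<le> mu3 N l b h D B L (2 * k + 1) g"
      and close: "\<And>i j. i \<in> {n..g n} \<Longrightarrow> j \<in> {n..g n} \<Longrightarrow> norm (x i - x j) \<le> 1 / (real (2 * k + 1) + 1)"
      using conv_x[of "2 * k + 1" g] by blast
    have "norm (y i - y j) \<le> 1 / (real k + 1)"
      if ij: "i \<in> {max n c..f (max n c)}" "j \<in> {max n c..f (max n c)}" for i j
    proof -
      have "norm (x i - w i) \<le> 1 / (2 * (2 * (real k + 1)))" "norm (x j - w j) \<le> 1 / (2 * (2 * (real k + 1)))"
        using ij by (intro xw[where m = 2]; simp add: c_def)+
      then have "norm (x i - w i) \<le> 1 / (real k + 1) / 4" "norm (x j - w j) \<le> 1 / (real k + 1) / 4"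
        by (simp_all add: algebra_simps)
      moreover have "norm (x i - x j) \<le> 1 / (real k + 1) / 2"
      proof -
        have "norm (x i - x j) \<le> 1 / (real (2 * k + 1) + 1)"
          using ij by (intro close) (auto simp: g_def)
        also have "real (2 * k + 1) + 1 = (real k + 1) * 2"
          by simp
        finally show ?thesis by simp
      qed
      moreover have "norm (y i - y j) \<le> norm (w i - w j)"
        using resolvent_nonexpansive[OF assms(2,3), of "w i" "w j"] assms(6) by (simp add: w_def)
      moreover have "norm (w i - w j) \<le> norm (x i - x j) + norm (x i - w i) + norm (x j - w j)"
      proof -
        have "w i - w j = (x i - x j) - (x i - w i) + (x j - w j)"
          by simp
        then show ?thesis
          using norm_triangle_ineq4[of "x i - x j" "x i - w i"] norm_triangle_ineq[of "(x i - x j) - (x i - w i)" "x j - w j"]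
          by simp
      qed
      moreover have "a \<le> e" if "p \<le> e / 4" "q \<le> e / 4" "r \<le> e / 2" "a \<le> d" "d \<le> r + p + q" for a d e p q r :: real
        using that by linarith
      ultimately show ?thesis by blast
    qed
    moreover have "max n c \<le> mu4 N l b h D B L k f"
      unfolding mu4_def Let_def using n unfolding g_def c_def by (rule max.mono) (rule order_refl)
    ultimately show ?thesis by blast
  qed
  have conv_z: "\<exists>n\<le>mu5 N l b h D B L k f. \<forall>i\<in>{n..f n}. \<forall>j\<in>{n..f n}. norm (z i - z j) \<le> 1 / (real k + 1)" for k f
  proof -
    define c where "c = max (nu1 N D B L (6 * l * (k + 1) - 1)) (b (12 * l * N * (k + 1) - 1))"
    define g where "g = (\<lambda>m. f (max m c))"
    obtain n where n: "n \<le> mu4 N l b h D B L (3 * k + 2) g"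
      and close: "\<And>i j. i \<in> {n..g n} \<Longrightarrow> j \<in> {n..g n} \<Longrightarrow> norm (y i - y j) \<le> 1 / (real (3 * k + 2) + 1)"
      using conv_y[of "3 * k + 2" g] by blast
    \<comment> \<open>Both summands of the residual bound are at most
      \<open>1 / (6 * l * (k + 1))\<close>; the factor \<open>2 * l\<close> gives
      \<open>2 / (3 * (k + 1))\<close> for the residual, which is twice
      \<open>|z i - y i|\<close>.\<close>
    have zy: "norm (z i - y i) \<le> 1 / (real k + 1) / 3" if "c \<le> i" for i
    proof -
      have "norm (x (Suc i) - x i) \<le> 1 / (real (6 * l * (k + 1) - 1) + 1)"
        using that by (intro nu1_rate) (simp add: c_def)
      also have "real (6 * l * (k + 1) - 1) + 1 = 2 * (3 * real l * (real k + 1))"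
        using assms(9) by (subst real_pred_plus_1) (auto simp: algebra_simps)
      finally have step: "norm (x (Suc i) - x i) \<le> 1 / (2 * (3 * real l * (real k + 1)))" .
      have "norm (x i - w i) \<le> 1 / (2 * (3 * real l * (real k + 1)))"
        using that assms(9) by (intro xw[where m = "3 * l"]) (auto simp: c_def)
      with step have "norm (x (Suc i) - x i) + norm (x i - w i)
          \<le> 1 / (2 * (3 * real l * (real k + 1))) + 1 / (2 * (3 * real l * (real k + 1)))"
        by (rule add_mono)
      also have "1 / (2 * c) + 1 / (2 * c) = 1 / c" for c :: real
        by (cases "c = 0") (simp_all add: field_simps)
      finally have sum: "norm (x (Suc i) - x i) + norm (x i - w i) \<le> 1 / (3 * real l * (real k + 1))" .
      have "2 * norm (z i - y i) = norm (T (w i) - w i)"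
        using T_minus[of i] by (simp add: w_def)
      also have "\<dots> \<le> real (2 * l) * (norm (x (Suc i) - x i) + norm (x i - w i))"
        by (rule norm_T_w_minus_w_le)
      also have "\<dots> \<le> real (2 * l) * (1 / (3 * real l * (real k + 1)))"
        by (intro mult_left_mono sum) simp
      also have "\<dots> = 2 * (1 / (real k + 1) / 3)"
        using assms(9) by simp
      finally show ?thesis by simp
    qed
    have "norm (z i - z j) \<le> 1 / (real k + 1)"
      if ij: "i \<in> {max n c..f (max n c)}" "j \<in> {max n c..f (max n c)}" for i j
    proof -
      have "norm (y i - y j) \<le> 1 / (real (3 * k + 2) + 1)"
        using ij by (intro close) (auto simp: g_def)
      also have "real (3 * k + 2) + 1 = (real k + 1) * 3"
        by simp
      finally have "norm (y i - y j) \<le> 1 / (real k + 1) / 3"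
        by simp
      moreover have "norm (z i - y i) \<le> 1 / (real k + 1) / 3" "norm (z j - y j) \<le> 1 / (real k + 1) / 3"
        using ij by (intro zy; simp)+
      moreover have "norm (z i - z j) \<le> norm (y i - y j) + norm (z i - y i) + norm (z j - y j)"
      proof -
        have "z i - z j = (y i - y j) + (z i - y i) - (z j - y j)"
          by simp
        then show ?thesis
          using norm_triangle_ineq[of "y i - y j" "z i - y i"] norm_triangle_ineq4[of "(y i - y j) + (z i - y i)" "z j - y j"]
          by simp
      qed
      moreover have "a \<le> e" if "r \<le> e / 3" "p \<le> e / 3" "q \<le> e / 3" "a \<le> r + p + q" for a e p q r :: real
        using that by linarith
      ultimately show ?thesis by blast
    qed
    moreover have "max n c \<le> mu5 N l b h D B L k f"
      unfolding mu5_def Let_def using n unfolding g_def c_def by (rule max.mono) (rule order_refl)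
    ultimately show ?thesis by blast
  qed
  show ?thesis
    using conv_x conv_y conv_z by blast
qed

end
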